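(* Let $T>0$ and let $U:\mathbb{R}\times\mathbb{R}^2\to\mathbb{R}$ be a $\mathcal{C}^1$ function which is $T$-periodic in its first variable. Suppose that there exist $C>0$ and $\alpha\in(0,2)$ such that $$|U(t,x)|\le C\,(1+|x|^{\alpha})\qquad\text{for every }(t,x)\in\mathbb{R}\times\mathbb{R}^2.$$ Then there exists at least one generalized $T$-periodic solution to the equation $$\ddot x=-\frac{x}{|x|^3}+\nabla_xU(t,x),\qquad x\in\mathbb{R}^2.$$
   Context: Definition. A generalized $T$-periodic solution to $\ddot x=-\frac{x}{|x|^3}+\nabla_xU(t,x)$ is a continuous and $T$-periodic function $x:\mathbb{R}\to\mathbb{R}^2$ satisfying the following conditions: (i) the set $E_x:=\{t\in\mathbb{R}: x(t)=0\}$ of collision instants is discrete; (ii) for any open interval $I\subset\mathbb{R}\setminus E_x$, the function $x$ is $\mathcal{C}^2(I)$ and satisfies the equation on $I$; (iii) for any $t_0\in E_x$, the (two-sided) limits $$\lim_{t\to t_0}\frac{x(t)}{|x(t)|}\qquad\text{and}\qquad\lim_{t\to t_0}\left(\frac12|\dot x(t)|^2-\frac{1}{|x(t)|}\right)$$ exist and are finite. *)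

theory Defs
  imports "HOL-Analysis.Analysis"
begin

definition continuously_differentiable ::
    "('a::real_normed_vector \<Rightarrow> 'b::real_normed_vector) \<Rightarrow> bool" where
  "continuously_differentiable f \<longleftrightarrow>
     (\<exists>f' :: 'a \<Rightarrow> 'a \<Rightarrow>\<^sub>L 'b.
        (\<forall>p. (f has_derivative blinfun_apply (f' p)) (at p)) \<and> continuous_on UNIV f')"

definition gradient :: "('a::real_inner \<Rightarrow> real) \<Rightarrow> 'a \<Rightarrow> 'a" where
  "gradient f x = (THE D. GDERIV f x :> D)"

abbreviation velocity :: "(real \<Rightarrow> 'a::real_normed_vector) \<Rightarrow> real \<Rightarrow> 'a" where
  "velocity x t \<equiv> vector_derivative x (at t)"

text \<open>
  For an open set \<open>I\<close> this is the class of twice continuously differentiable curves on \<open>I\<close>.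
  For other sets it is more demanding, because \<^const>\<open>C1_differentiable_on\<close> refers to
  derivatives in a full neighbourhood.
\<close>

definition C2_differentiable_on ::
    "(real \<Rightarrow> 'a::real_normed_vector) \<Rightarrow> real set \<Rightarrow> bool"  (infix "C2'_differentiable'_on" 50) where
  "x C2_differentiable_on I \<longleftrightarrow>
     x C1_differentiable_on I \<and> velocity x C1_differentiable_on I"

definition collision_instants :: "(real \<Rightarrow> real^2) \<Rightarrow> real set" where
  "collision_instants x = {t. x t = 0}"

text \<open>
  Generalized \<open>T\<close>-periodic solutions of \<open>x'' = - x / |x|\<^sup>3 + \<nabla>\<^sub>x U(t, x)\<close>. The period \<open>T\<close>
  need not be minimal, and the intervals \<open>I\<close> may be unbounded.
\<close>

definition generalized_periodic_solution ::
    "real \<Rightarrow> (real \<times> (real^2) \<Rightarrow> real) \<Rightarrow> (real \<Rightarrow> real^2) \<Rightarrow> bool" where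
  "generalized_periodic_solution T U x \<longleftrightarrow>
     continuous_on UNIV x \<and>
     (\<forall>t. x (t + T) = x t) \<and>
     discrete (collision_instants x) \<and>
     (\<forall>I. open I \<and> is_interval I \<and> I \<subseteq> - collision_instants x \<longrightarrow>
        x C2_differentiable_on I \<and>
        (\<forall>t\<in>I. velocity (velocity x) t =
                 - (x t /\<^sub>R norm (x t) ^ 3) + gradient (\<lambda>y. U (t, y)) (x t))) \<and>
     (\<forall>t\<^sub>0 \<in> collision_instants x.
        (\<exists>l. ((\<lambda>t. x t /\<^sub>R norm (x t)) \<longlongrightarrow> l) (at t\<^sub>0)) \<and>
        (\<exists>h. ((\<lambda>t. (1/2) * norm (velocity x t) ^ 2 - 1 / norm (x t)) \<longlongrightarrow> h) (at t\<^sub>0)))"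

end

theory Submission
  imports Defs "HOL-Complex_Analysis.Great_Picard"
begin

text \<open>
  Identify the plane with \<open>\<complex>\<close>. The Levi-Civita substitution \<open>x = z\<^sup>2\<close>, together with a new time \<open>s\<close>
  such that \<open>dt = S |z|\<^sup>2 ds\<close>, removes the singularity. Let \<open>z\<close> be antiperiodic, \<open>z (s + 1) = - z s\<close>,
  so that \<open>x\<close> is a loop; put \<open>N = \<integral>|z|\<^sup>2\<close> and \<open>e = \<integral>|z'|\<^sup>2\<close> over a unit interval. The
  requirement that the loop lasts for the time \<open>T\<close> forces \<open>S = T / N\<close>, and the Lagrangian action of \<open>x\<close>
  becomes
    \<open>action z \<tau> e = (2 / T) N e + T / N + (T / N) \<integral>|z|\<^sup>2 U (t s, z\<^sup>2) ds\<close>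
  with \<open>t s = \<tau> + S \<integral>\<^sub>0\<^sup>s |z|\<^sup>2\<close>. This expression is regular where \<open>z\<close> vanishes. A solution is obtained
  by minimising it over \<open>z\<close> and the starting time \<open>\<tau>\<close>; collisions are not excluded, but
  they turn out to be harmless.

  \<^bold>\<open>Coercivity.\<close> Antiperiodicity gives the Poincare inequality \<open>4 N \<le> e\<close> and the interpolation inequality
  \<open>max |z|\<^sup>2 \<le> (5 / 2) sqrt (N e)\<close>. As \<open>|U|\<close> grows at most like \<open>|x|\<^sup>\<alpha>\<close> with \<open>\<alpha> < 2\<close>, the last term of the action is
  dominated by the first one. So on a minimising sequence of \<open>C\<^sup>2\<close> curves \<open>e\<close> is
  bounded, and \<open>T / N\<close> keeps \<open>N\<close> away from \<open>0\<close>. Holder bounds and the Arzela-Ascoli theorem yield a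
  subsequence that converges to a continuous \<open>z\<close>, with numbers \<open>\<tau>\<close> and \<open>e\<close> as limits of the starting times and
  the energies (\<open>relaxed_minimiser\<close>). No derivative of the limit is needed: when \<open>z\<close> is perturbed by
  \<open>\<epsilon> \<phi>\<close>, the energy changes by \<open>- 2 \<epsilon> \<integral> z \<bullet> \<phi>'' + \<epsilon>\<^sup>2 \<integral>|\<phi>'|\<^sup>2\<close>, which passes to the limit.

  \<^bold>\<open>Euler-Lagrange equation.\<close> Differentiating in \<open>\<epsilon>\<close> gives \<open>\<integral> z \<bullet> \<phi>'' = \<integral> G \<bullet> \<phi>\<close> for all antiperiodic \<open>\<phi>\<close>
  of class \<open>C\<^sup>2\<close>, with a continuous antiperiodic \<open>G\<close> (\<open>euler_lagrange\<close>). Choosing for \<open>\<phi>\<close> the double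
  primitive of the difference between \<open>z\<close> and the double primitive of \<open>G\<close> shows that \<open>z\<close> is \<open>C\<^sup>2\<close>
  and \<open>z'' = G\<close>. Minimality among \<open>C\<^sup>2\<close> curves then identifies \<open>e\<close> with \<open>\<integral>|z'|\<^sup>2\<close>.

  \<^bold>\<open>Energy.\<close> \<open>G\<close> has the form \<open>(S\<^sup>2 / 2) (w z + |z|\<^sup>2 cnj z \<nabla>U)\<close>, where \<open>w\<close> is a continuous function that will be the
  Kepler energy. The identity \<open>(2 / S\<^sup>2) |z'|\<^sup>2 = 1 + w |z|\<^sup>2\<close> (\<open>energy_identity\<close>) holds up to an additive constant by
  differentiation, and the constant is right because both sides have the same integral. At a
  zero of \<open>z\<close> it gives \<open>z' \<noteq> 0\<close>. Hence zeros are isolated, \<open>t\<close> is a homeomorphism of the line, and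
  \<open>x (t s) = (z s)\<^sup>2\<close> satisfies the equation off the collisions. At a collision \<open>x / |x|\<close>
  tends to \<open>(z' / |z'|)\<^sup>2\<close> from both sides, since squaring forgets the sign of \<open>z'\<close>, and
  \<open>|x'|\<^sup>2 / 2 - 1 / |x| = w\<close> is continuous.
\<close>

section \<open>Primitives and antiperiodic curves\<close>

text \<open>
  The second integral gives the primitive its sign to the left of \<open>0\<close>, so that it is an antiderivative
  on the whole line.
\<close>
definition primitive :: "(real \<Rightarrow> 'a::banach) \<Rightarrow> real \<Rightarrow> 'a" where
  "primitive f s = integral {0..s} f - integral {s..0} f"

lemma primitive_0 [simp]: "primitive f 0 = 0"
  by (simp add: primitive_def)

lemma primitive_nonneg_eq: "0 \<le> s \<Longrightarrow> primitive f s = integral {0..s} f"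
  by (cases "s = 0") (auto simp: primitive_def)

lemma primitive_has_vector_derivative:
  fixes f :: "real \<Rightarrow> 'a::banach"
  assumes "continuous_on UNIV f"
  shows "(primitive f has_vector_derivative f s) (at s)"
proof -
  define a b where "a = - \<bar>s\<bar> - 1" and "b = \<bar>s\<bar> + 1"
  have ab: "a < s" "s < b" "a < 0" "0 < b" by (auto simp: a_def b_def)
  have int: "f integrable_on {c..d}" for c d
    by (rule integrable_continuous_real) (rule continuous_on_subset[OF assms], simp)
  have eq: "primitive f u = integral {a..u} f - integral {a..0} f" if "u \<in> {a..b}" for u
  proof (cases "0 \<le> u")
    case True
    have "integral {a..0} f + integral {0..u} f = integral {a..u} f"
      using True ab int by (intro Henstock_Kurzweil_Integration.integral_combine) auto
    then show ?thesis using True by (simp add: primitive_nonneg_eq algebra_simps)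
  next
    case False
    have "integral {a..u} f + integral {u..0} f = integral {a..0} f"
      using False ab that int by (intro Henstock_Kurzweil_Integration.integral_combine) auto
    then show ?thesis using False by (simp add: primitive_def algebra_simps)
  qed
  have "((\<lambda>u. integral {a..u} f) has_vector_derivative f s) (at s within {a..b})"
    using ab by (intro integral_has_vector_derivative continuous_on_subset[OF assms]) auto
  then have "((\<lambda>u. integral {a..u} f - integral {a..0} f) has_vector_derivative f s - 0) (at s within {a..b})"
    by (intro derivative_intros)
  then have "(primitive f has_vector_derivative f s) (at s within {a..b})"
    using has_vector_derivative_transform[of s "{a..b}" "primitive f"] eq ab by auto
  then show ?thesis using ab by (simp add: at_within_Icc_at)
qed

lemma eq_of_same_vector_derivative:
  fixes f g :: "real \<Rightarrow> 'a::real_normed_vector"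
  assumes "\<And>s. (f has_vector_derivative h s) (at s)" "\<And>s. (g has_vector_derivative h s) (at s)"
    and "f a = g a"
  shows "f s = g s"
proof -
  have "((\<lambda>s. f s - g s) has_vector_derivative 0) (at s within UNIV)" for s
    using has_vector_derivative_diff[OF assms(1,2)] by simp
  then obtain c where "\<And>s. f s - g s = c"
    using has_vector_derivative_zero_constant[of UNIV "\<lambda>s. f s - g s"] by auto
  with assms(3) show ?thesis by (metis eq_iff_diff_eq_0)
qed

lemma has_vector_derivative_shift:
  "(f has_vector_derivative d) (at (s + a)) \<Longrightarrow> ((\<lambda>s. f (s + a)) has_vector_derivative d) (at s)"
  using vector_diff_chain_at[of "\<lambda>s. s + a" 1 s f d]
  by (simp add: o_def has_vector_derivative_add_const has_vector_derivative_id)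

lemma primitive_shift:
  fixes f :: "real \<Rightarrow> 'a::banach"
  assumes "continuous_on UNIV f" "\<And>s. f (s + 1) = f s"
  shows "primitive f (s + 1) = primitive f s + primitive f 1"
proof (rule eq_of_same_vector_derivative[where h = f and a = 0 and s = s and
      f = "\<lambda>s. primitive f (s + 1)" and g = "\<lambda>s. primitive f s + primitive f 1"])
  show "((\<lambda>s. primitive f (s + 1)) has_vector_derivative f s) (at s)" for s
    using has_vector_derivative_shift[OF primitive_has_vector_derivative[OF assms(1)], where s = s and a = 1] assms(2) by simp
  show "((\<lambda>s. primitive f s + primitive f 1) has_vector_derivative f s) (at s)" for s
    using primitive_has_vector_derivative[OF assms(1), of s] by (simp add: has_vector_derivative_add_const)
qed simp

lemma continuous_on_of_vector_derivative:
  "(\<And>s. (f has_vector_derivative f' s) (at s)) \<Longrightarrow> continuous_on UNIV f"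
  by (meson continuous_at_imp_continuous_on has_vector_derivative_continuous)

lemma continuous_on_primitive:
  "continuous_on UNIV f \<Longrightarrow> continuous_on UNIV (primitive f)"
  by (rule continuous_on_of_vector_derivative[OF primitive_has_vector_derivative])

lemma continuous_on_primitive_compose:
  "continuous_on UNIV f \<Longrightarrow> continuous_on S g \<Longrightarrow> continuous_on S (\<lambda>x. primitive f (g x))"
  by (rule continuous_on_compose2[OF continuous_on_primitive]) auto

lemma integral_of_vector_derivative:
  fixes f :: "real \<Rightarrow> 'a::banach"
  assumes "\<And>s. (f has_vector_derivative f' s) (at s)"
  shows "integral {0..1} f' = f 1 - f 0"
  by (rule integral_unique, rule fundamental_theorem_of_calculus)
    (auto intro: has_vector_derivative_at_within assms)

lemma integrable_unit: "continuous_on UNIV f \<Longrightarrow> (f :: real \<Rightarrow> 'a::banach) integrable_on {a..b}"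
  by (rule integrable_continuous_real) (rule continuous_on_subset, auto)

definition antiperiodic :: "(real \<Rightarrow> 'a::real_normed_vector) \<Rightarrow> bool" where
  "antiperiodic z \<longleftrightarrow> (\<forall>s. z (s + 1) = - z s)"

lemma antiperiodicD: "antiperiodic z \<Longrightarrow> z (s + 1) = - z s"
  by (simp add: antiperiodic_def)

lemma antiperiodic_derivative:
  assumes "antiperiodic z" "\<And>s. (z has_vector_derivative z' s) (at s)"
  shows "antiperiodic z'"
  unfolding antiperiodic_def
proof
  fix s
  have "((\<lambda>s. z (s + 1)) has_vector_derivative z' (s + 1)) (at s)"
    by (rule has_vector_derivative_shift[OF assms(2)])
  moreover have "((\<lambda>s. z (s + 1)) has_vector_derivative - z' s) (at s)"
    using has_vector_derivative_minus[OF assms(2)] assms(1) by (simp add: antiperiodic_def)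
  ultimately show "z' (s + 1) = - z' s"
    by (rule vector_derivative_unique_at)
qed

text \<open>
  The integration constant is forced: half the integral over a unit interval, with a minus sign. This makes
  integration an operation on antiperiodic curves, so test functions can be prescribed by their
  second derivative.
\<close>
lemma antiperiodic_primitive_exists:
  fixes g :: "real \<Rightarrow> 'a::banach"
  assumes "continuous_on UNIV g" "antiperiodic g"
  obtains G where "antiperiodic G" "\<And>s. (G has_vector_derivative g s) (at s)"
proof -
  define h where "h = (1/2) *\<^sub>R primitive g 1"
  have h: "primitive g 1 = h + h"
    by (simp add: h_def flip: scaleR_add_left)
  define G where "G s = primitive g s - h" for s
  have der: "(G has_vector_derivative g s) (at s)" for s
    unfolding G_def using has_vector_derivative_diff[OF primitive_has_vector_derivative[OF assms(1)] has_vector_derivative_const]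
    by simp
  have "G (s + 1) = - G s" for s
  proof (rule eq_of_same_vector_derivative[where h = "\<lambda>s. - g s" and a = 0 and s = s and
      f = "\<lambda>s. G (s + 1)" and g = "\<lambda>s. - G s"])
    show "((\<lambda>s. G (s + 1)) has_vector_derivative - g s) (at s)" for s
      using has_vector_derivative_shift[OF der, where s = s and a = 1] assms(2) by (simp add: antiperiodic_def)
    show "((\<lambda>s. - G s) has_vector_derivative - g s) (at s)" for s
      by (rule has_vector_derivative_minus[OF der])
    show "G (0 + 1) = - G 0"
      by (simp add: G_def h)
  qed
  then have "antiperiodic G" by (simp add: antiperiodic_def)
  with der that show thesis by blast
qed

text \<open>
  There are no boundary terms, because the inner product of two antiperiodic curves is periodic.
\<close>
lemma antiperiodic_integral_by_parts:
  fixes u v :: "real \<Rightarrow> 'a::euclidean_space"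
  assumes u: "antiperiodic u" "\<And>s. (u has_vector_derivative u' s) (at s)" "continuous_on UNIV u'"
    and v: "antiperiodic v" "\<And>s. (v has_vector_derivative v' s) (at s)" "continuous_on UNIV v'"
  shows "integral {0..1} (\<lambda>s. u s \<bullet> v' s) = - integral {0..1} (\<lambda>s. u' s \<bullet> v s)"
proof -
  have [continuous_intros]: "continuous_on UNIV u" "continuous_on UNIV v"
    using continuous_on_of_vector_derivative u(2) v(2) by blast+
  have "((\<lambda>s. u s \<bullet> v s) has_vector_derivative (u s \<bullet> v' s + u' s \<bullet> v s)) (at s)" for s
    by (rule bounded_bilinear.has_vector_derivative[OF bounded_bilinear_inner u(2) v(2)])
  from integral_of_vector_derivative[OF this]
  have "integral {0..1} (\<lambda>s. u s \<bullet> v' s + u' s \<bullet> v s) = u 1 \<bullet> v 1 - u 0 \<bullet> v 0" .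
  also have "\<dots> = 0"
    using antiperiodicD[OF u(1), of 0] antiperiodicD[OF v(1), of 0] by simp
  finally show ?thesis
    by (subst (asm) integral_add) (auto intro!: integrable_unit continuous_intros u(3) v(3))
qed

text \<open>
  Optimising the weight \<open>c\<close> turns a family of arithmetic-geometric mean bounds into a Cauchy-Schwarz bound.
\<close>
lemma square_le_of_weighted_bounds:
  fixes X A B :: real
  assumes bound: "\<And>c. c > 0 \<Longrightarrow> X \<le> c / 2 * A + B / (2 * c)" and "X \<ge> 0" "A \<ge> 0" "B \<ge> 0"
  shows "X\<^sup>2 \<le> A * B"
proof (cases "X = 0")
  case False
  then have X: "X > 0" using assms by simp
  show ?thesis
  proof (cases "A = 0")
    case True
    show ?thesis
    proof (cases "B = 0")
      case True
      then show ?thesis using bound[of 1] \<open>A = 0\<close> X by simp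
    next
      case False
      then have "X \<le> B / (2 * (B / X))" using bound[of "B / X"] \<open>A = 0\<close> X \<open>B \<ge> 0\<close> by simp
      then show ?thesis using False X by simp
    qed
  next
    case False
    then have A: "A > 0" using assms by simp
    have "X \<le> X / 2 + B * A / (2 * X)" using bound[of "X / A"] A X by (simp add: field_simps)
    then have "X * X \<le> (X / 2 + B * A / (2 * X)) * X" using X by (intro mult_right_mono) auto
    also have "\<dots> = X * X / 2 + A * B / 2" using X by (simp add: field_simps)
    finally show ?thesis by (simp add: power2_eq_square)
  qed
qed (use assms in simp)

definition mean_square :: "(real \<Rightarrow> 'a::euclidean_space) \<Rightarrow> real" where
  "mean_square v = integral {0..1} (\<lambda>s. (norm (v s))\<^sup>2)"

lemma mean_square_nonneg: "mean_square v \<ge> 0"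
  unfolding mean_square_def
  by (cases "(\<lambda>s. (norm (v s))\<^sup>2) integrable_on {0..1}")
    (auto intro: integral_nonneg simp: not_integrable_integral)

text \<open>
  The pointwise estimate \<open>g h \<le> c / 2 g\<^sup>2 + h\<^sup>2 / (2 c)\<close> under the integral; with \<open>square_le_of_weighted_bounds\<close>
  it replaces the Cauchy-Schwarz inequality for integrals.
\<close>
lemma weighted_derivative_bound:
  fixes f f' :: "real \<Rightarrow> 'a::euclidean_space"
  assumes "a \<le> b" "\<And>s. (f has_vector_derivative f' s) (at s)"
    and cont: "continuous_on UNIV g" "continuous_on UNIV h" and "c > 0"
    and bound: "\<And>s. norm (f' s) \<le> g s * h s"
  shows "norm (f b - f a) \<le> c / 2 * (primitive (\<lambda>s. (g s)\<^sup>2) b - primitive (\<lambda>s. (g s)\<^sup>2) a)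
            + (primitive (\<lambda>s. (h s)\<^sup>2) b - primitive (\<lambda>s. (h s)\<^sup>2) a) / (2 * c)"
proof (cases "a = b")
  case False
  define \<phi> where "\<phi> s = c / 2 * primitive (\<lambda>s. (g s)\<^sup>2) s + primitive (\<lambda>s. (h s)\<^sup>2) s / (2 * c)" for s
  have p: "(primitive (\<lambda>s. (k s)\<^sup>2) has_real_derivative (k s)\<^sup>2) (at s)"
    if "continuous_on UNIV k" for k :: "real \<Rightarrow> real" and s
    unfolding has_real_derivative_iff_has_vector_derivative
    by (rule primitive_has_vector_derivative) (intro continuous_intros that)
  have \<phi>: "(\<phi> has_vector_derivative (c / 2 * (g s)\<^sup>2 + (h s)\<^sup>2 / (2 * c))) (at s)" for s
    unfolding \<phi>_def has_real_derivative_iff_has_vector_derivative[symmetric]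
    by (intro DERIV_add DERIV_cmult DERIV_cdivide p cont)
  have "norm (f b - f a) \<le> \<phi> b - \<phi> a"
  proof (rule differentiable_bound_general)
    show "norm (f' s) \<le> c / 2 * (g s)\<^sup>2 + (h s)\<^sup>2 / (2 * c)" for s
    proof -
      have "0 \<le> (c * g s - h s)\<^sup>2 / (2 * c)" using \<open>c > 0\<close> by simp
      also have "\<dots> = c / 2 * (g s)\<^sup>2 + (h s)\<^sup>2 / (2 * c) - g s * h s"
        using \<open>c > 0\<close> by (simp add: field_simps power2_eq_square)
      finally show ?thesis using bound[of s] by linarith
    qed
    show "a < b" using assms(1) False by simp
    show "continuous_on {a..b} f" "continuous_on {a..b} \<phi>"
      using continuous_on_of_vector_derivative[OF assms(2)] continuous_on_of_vector_derivative[OF \<phi>]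
      by (auto intro: continuous_on_subset)
  qed (rule assms(2) \<phi>)+
  then show ?thesis by (simp add: \<phi>_def right_diff_distrib diff_divide_distrib)
qed simp

lemma mean_square_eq_primitive: "mean_square v = primitive (\<lambda>s. (norm (v s))\<^sup>2) 1"
  by (simp add: mean_square_def primitive_nonneg_eq)

lemma primitive_has_real_derivative:
  "continuous_on UNIV f \<Longrightarrow> (primitive f has_real_derivative f s) (at s)"
  unfolding has_real_derivative_iff_has_vector_derivative by (rule primitive_has_vector_derivative)

lemma norm_add_scaled_square:
  fixes a b :: "'a::real_inner"
  shows "(norm (a + \<epsilon> *\<^sub>R b))\<^sup>2 = (norm a)\<^sup>2 + 2 * \<epsilon> * (a \<bullet> b) + \<epsilon>\<^sup>2 * (norm b)\<^sup>2"
  unfolding power2_norm_eq_inner power2_eq_square[of \<epsilon>] inner_add_left inner_add_right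
    inner_scaleR_left inner_scaleR_right inner_commute[of b a]
  by algebra

lemma primitive_add_scaled_square:
  fixes u v :: "real \<Rightarrow> 'a::euclidean_space"
  assumes "continuous_on UNIV u" "continuous_on UNIV v"
  shows "primitive (\<lambda>s. (norm (u s + \<epsilon> *\<^sub>R v s))\<^sup>2) s = primitive (\<lambda>s. (norm (u s))\<^sup>2) s
    + 2 * \<epsilon> * primitive (\<lambda>s. u s \<bullet> v s) s + \<epsilon>\<^sup>2 * primitive (\<lambda>s. (norm (v s))\<^sup>2) s"
proof -
  let ?g = "\<lambda>s. primitive (\<lambda>s. (norm (u s))\<^sup>2) s
    + 2 * \<epsilon> * primitive (\<lambda>s. u s \<bullet> v s) s + \<epsilon>\<^sup>2 * primitive (\<lambda>s. (norm (v s))\<^sup>2) s"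
  show ?thesis
  proof (rule eq_of_same_vector_derivative[where a = 0 and s = s and
      f = "primitive (\<lambda>s. (norm (u s + \<epsilon> *\<^sub>R v s))\<^sup>2)" and g = ?g])
    show "(primitive (\<lambda>s. (norm (u s + \<epsilon> *\<^sub>R v s))\<^sup>2) has_vector_derivative (norm (u s + \<epsilon> *\<^sub>R v s))\<^sup>2) (at s)" for s
      by (rule primitive_has_vector_derivative) (intro continuous_intros assms)
    show "(?g has_vector_derivative (norm (u s + \<epsilon> *\<^sub>R v s))\<^sup>2) (at s)" for s
      unfolding norm_add_scaled_square has_real_derivative_iff_has_vector_derivative[symmetric]
      by (intro DERIV_add DERIV_cmult primitive_has_real_derivative continuous_intros assms)
  qed simp
qed

lemma mean_square_add_scaled:
  fixes u v :: "real \<Rightarrow> 'a::euclidean_space"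
  assumes "continuous_on UNIV u" "continuous_on UNIV v"
  shows "mean_square (\<lambda>s. u s + \<epsilon> *\<^sub>R v s)
    = mean_square u + 2 * \<epsilon> * integral {0..1} (\<lambda>s. u s \<bullet> v s) + \<epsilon>\<^sup>2 * mean_square v"
  using primitive_add_scaled_square[OF assms, of \<epsilon> 1]
  by (simp add: mean_square_eq_primitive primitive_nonneg_eq[of 1])

lemma primitive_mono:
  fixes f :: "real \<Rightarrow> real"
  assumes "continuous_on UNIV f" "\<And>s. f s \<ge> 0" "a \<le> b"
  shows "primitive f a \<le> primitive f b"
  using assms primitive_has_vector_derivative[OF assms(1)]
  by (intro DERIV_nonneg_imp_nondecreasing[OF assms(3)])
    (auto simp: has_real_derivative_iff_has_vector_derivative)

lemma antiperiodic_holder_bound: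
  fixes z z' :: "real \<Rightarrow> 'a::euclidean_space"
  assumes z: "antiperiodic z" "\<And>s. (z has_vector_derivative z' s) (at s)" "continuous_on UNIV z'"
    and ab: "a \<le> b" "b \<le> a + 1"
  shows "(norm (z b - z a))\<^sup>2 \<le> mean_square z' * (b - a)"
proof (rule square_le_of_weighted_bounds)
  let ?g = "\<lambda>s. norm (z' s)"
  have cont: "continuous_on UNIV ?g" "continuous_on UNIV (\<lambda>s. (?g s)\<^sup>2)"
    by (intro continuous_intros z(3))+
  have "primitive (\<lambda>s. (?g s)\<^sup>2) b \<le> primitive (\<lambda>s. (?g s)\<^sup>2) (a + 1)"
    by (rule primitive_mono) (use cont ab in auto)
  also have "\<dots> = primitive (\<lambda>s. (?g s)\<^sup>2) a + mean_square z'"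
    unfolding mean_square_eq_primitive using antiperiodicD[OF antiperiodic_derivative[OF z(1,2)]]
    by (intro primitive_shift cont) simp
  finally have le: "primitive (\<lambda>s. (?g s)\<^sup>2) b - primitive (\<lambda>s. (?g s)\<^sup>2) a \<le> mean_square z'" by simp
  have one: "primitive (\<lambda>s. (1::real)\<^sup>2) s = s" for s
    by (cases "0 \<le> s") (auto simp: primitive_def)
  fix c :: real assume c: "c > 0"
  have "norm (z b - z a) \<le> c / 2 * (primitive (\<lambda>s. (?g s)\<^sup>2) b - primitive (\<lambda>s. (?g s)\<^sup>2) a) + (b - a) / (2 * c)"
    using weighted_derivative_bound[OF ab(1) z(2) cont(1) continuous_on_const[of _ 1] c] unfolding one by simp
  also have "\<dots> \<le> c / 2 * mean_square z' + (b - a) / (2 * c)"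
    using le c by (intro add_right_mono mult_left_mono) auto
  finally show "norm (z b - z a) \<le> c / 2 * mean_square z' + (b - a) / (2 * c)" .
qed (use ab mean_square_nonneg in auto)

text \<open>
  Over a unit interval an antiperiodic curve moves from \<open>z s\<close> to \<open>- z s\<close>, a distance of \<open>2 |z s|\<close>.
\<close>
lemma antiperiodic_poincare:
  fixes z z' :: "real \<Rightarrow> 'a::euclidean_space"
  assumes z: "antiperiodic z" "\<And>s. (z has_vector_derivative z' s) (at s)" "continuous_on UNIV z'"
  shows "4 * (norm (z s))\<^sup>2 \<le> mean_square z'"
proof -
  have "z (s + 1) - z s = - (2 *\<^sub>R z s)"
    using antiperiodicD[OF z(1), of s] by (simp add: scaleR_2)
  then have "norm (z (s + 1) - z s) = 2 * norm (z s)" by simp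
  then show ?thesis
    using antiperiodic_holder_bound[OF z, of s "s + 1"] by (simp add: power_mult_distrib)
qed

lemma mean_square_poincare:
  fixes z z' :: "real \<Rightarrow> 'a::euclidean_space"
  assumes z: "antiperiodic z" "\<And>s. (z has_vector_derivative z' s) (at s)" "continuous_on UNIV z'"
  shows "4 * mean_square z \<le> mean_square z'"
proof -
  have "continuous_on UNIV z" by (rule continuous_on_of_vector_derivative[OF z(2)])
  then have "mean_square z \<le> integral {0..1::real} (\<lambda>s. mean_square z' / 4)"
    unfolding mean_square_def[of z] using antiperiodic_poincare[OF z]
    by (intro integral_le integrable_unit continuous_intros) (auto simp: field_simps)
  then show ?thesis by simp
qed

text \<open>
  The derivative of \<open>|z|\<^sup>2\<close> is at most \<open>2 |z| |z'|\<close>, so \<open>|z|\<^sup>2\<close> exceeds its mean by at most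
  \<open>2 sqrt (N E)\<close>, where \<open>N\<close> and \<open>E\<close> are the mean squares of \<open>z\<close> and \<open>z'\<close>; the mean \<open>N\<close> itself is at
  most \<open>sqrt (N E) / 2\<close> by the Poincare inequality.
\<close>
lemma antiperiodic_interpolation:
  fixes z z' :: "real \<Rightarrow> 'a::euclidean_space"
  assumes z: "antiperiodic z" "\<And>s. (z has_vector_derivative z' s) (at s)" "continuous_on UNIV z'"
    and s: "s \<in> {0..1}"
  shows "(norm (z s))\<^sup>2 \<le> 5 / 2 * sqrt (mean_square z * mean_square z')"
proof -
  let ?N = "mean_square z" and ?E = "mean_square z'"
  have contz: "continuous_on UNIV z" by (rule continuous_on_of_vector_derivative[OF z(2)])
  have der: "((\<lambda>s. z s \<bullet> z s) has_vector_derivative 2 * (z s \<bullet> z' s)) (at s)" for s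
    using bounded_bilinear.has_vector_derivative[OF bounded_bilinear_inner z(2) z(2), of s]
    by (simp add: inner_commute)
  have bound: "norm (2 * (z s \<bullet> z' s)) \<le> norm (z' s) * (2 * norm (z s))" for s
    using Cauchy_Schwarz_ineq2[of "z s" "z' s"] by (simp add: mult.commute abs_mult)
  have cont: "continuous_on UNIV (\<lambda>s. norm (z' s))" "continuous_on UNIV (\<lambda>s. 2 * norm (z s))"
    by (intro continuous_intros z(3) contz)+
  have *: "\<bar>(norm (z b))\<^sup>2 - (norm (z a))\<^sup>2\<bar> \<le> 2 * sqrt (?N * ?E)"
    if ab: "a \<in> {0..1}" "b \<in> {0..1}" "a \<le> b" for a b
  proof -
    have "\<bar>(norm (z b))\<^sup>2 - (norm (z a))\<^sup>2\<bar>\<^sup>2 \<le> ?E * (4 * ?N)"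
    proof (rule square_le_of_weighted_bounds)
      fix c :: real assume c: "c > 0"
      have inc: "primitive (\<lambda>s. (g s)\<^sup>2) b - primitive (\<lambda>s. (g s)\<^sup>2) a \<le> integral {0..1} (\<lambda>s. (g s)\<^sup>2)"
        if "continuous_on UNIV g" for g :: "real \<Rightarrow> real"
      proof -
        have c2: "continuous_on UNIV (\<lambda>s. (g s)\<^sup>2)" by (intro continuous_intros that)
        show ?thesis
          using primitive_mono[OF c2, of b 1] primitive_mono[OF c2, of 0 a] ab
          by (auto simp: primitive_nonneg_eq[of 1])
      qed
      have "norm (z b \<bullet> z b - z a \<bullet> z a) \<le> c / 2 * integral {0..1} (\<lambda>s. (norm (z' s))\<^sup>2)
          + integral {0..1} (\<lambda>s. (2 * norm (z s))\<^sup>2) / (2 * c)"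
        by (rule order_trans[OF weighted_derivative_bound[OF ab(3) der cont c bound]])
          (use inc[OF cont(1)] inc[OF cont(2)] c in \<open>intro add_mono mult_left_mono divide_right_mono; simp\<close>)
      then show "\<bar>(norm (z b))\<^sup>2 - (norm (z a))\<^sup>2\<bar> \<le> c / 2 * ?E + 4 * ?N / (2 * c)"
        by (simp add: mean_square_def power2_norm_eq_inner power_mult_distrib)
    qed (use mean_square_nonneg in auto)
    then have "\<bar>(norm (z b))\<^sup>2 - (norm (z a))\<^sup>2\<bar> \<le> sqrt (4 * (?N * ?E))"
      by (intro real_le_rsqrt) (simp add: ac_simps)
    then show ?thesis by (simp add: real_sqrt_mult)
  qed
  have "(norm (z s))\<^sup>2 - 2 * sqrt (?N * ?E) \<le> (norm (z a))\<^sup>2" if "a \<in> {0..1}" for a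
    using *[of a s] *[of s a] that s by (cases "a \<le> s") (auto simp: abs_le_iff)
  then have "integral {0..1::real} (\<lambda>a. (norm (z s))\<^sup>2 - 2 * sqrt (?N * ?E)) \<le> ?N"
    unfolding mean_square_def[of z] by (intro integral_le integrable_unit continuous_intros contz) auto
  then have 1: "(norm (z s))\<^sup>2 \<le> ?N + 2 * sqrt (?N * ?E)" by simp
  have "(2 * ?N)\<^sup>2 \<le> ?N * ?E"
    using mult_left_mono[OF mean_square_poincare[OF z] mean_square_nonneg[of z]]
    by (simp add: power2_eq_square)
  then have "2 * ?N \<le> sqrt (?N * ?E)" by (rule real_le_rsqrt)
  with 1 show ?thesis by simp
qed

section \<open>The regularised action\<close>

definition C2_loop :: "(real \<Rightarrow> complex) \<Rightarrow> (real \<Rightarrow> complex) \<Rightarrow> (real \<Rightarrow> complex) \<Rightarrow> bool" where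
  "C2_loop z z' z'' \<longleftrightarrow> antiperiodic z \<and> (\<forall>s. (z has_vector_derivative z' s) (at s)) \<and>
     (\<forall>s. (z' has_vector_derivative z'' s) (at s)) \<and> continuous_on UNIV z''"

lemma C2_loopD:
  assumes "C2_loop z z' z''"
  shows "antiperiodic z" "antiperiodic z'" "antiperiodic z''"
    "\<And>s. (z has_vector_derivative z' s) (at s)" "\<And>s. (z' has_vector_derivative z'' s) (at s)"
    "continuous_on UNIV z" "continuous_on UNIV z'" "continuous_on UNIV z''"
proof -
  show 1: "antiperiodic z" and 2: "(z has_vector_derivative z' s) (at s)"
    and 3: "(z' has_vector_derivative z'' s) (at s)" and "continuous_on UNIV z''" for s
    using assms unfolding C2_loop_def by auto
  show 4: "antiperiodic z'" by (rule antiperiodic_derivative[OF 1 2])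
  show "antiperiodic z''" by (rule antiperiodic_derivative[OF 4 3])
  show "continuous_on UNIV z" "continuous_on UNIV z'"
    using continuous_on_of_vector_derivative 2 3 by blast+
qed

lemma C2_loop_add_scaled:
  assumes "C2_loop z z' z''" "C2_loop \<phi> \<phi>' \<phi>''"
  shows "C2_loop (\<lambda>s. z s + \<epsilon> *\<^sub>R \<phi> s) (\<lambda>s. z' s + \<epsilon> *\<^sub>R \<phi>' s) (\<lambda>s. z'' s + \<epsilon> *\<^sub>R \<phi>'' s)"
  using assms unfolding C2_loop_def antiperiodic_def
  by (auto intro!: continuous_intros has_vector_derivative_add
      bounded_linear.has_vector_derivative[OF bounded_linear_scaleR_right] simp: algebra_simps)

text \<open>
  After an integration by parts the mixed term involves \<open>z\<close> but not its derivative. So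
  it is continuous under pointwise bounded convergence of \<open>z\<close>.
\<close>
lemma energy_add_scaled:
  assumes "C2_loop z z' z''" "C2_loop \<phi> \<phi>' \<phi>''"
  shows "mean_square (\<lambda>s. z' s + \<epsilon> *\<^sub>R \<phi>' s)
    = mean_square z' - 2 * \<epsilon> * integral {0..1} (\<lambda>s. z s \<bullet> \<phi>'' s) + \<epsilon>\<^sup>2 * mean_square \<phi>'"
  using antiperiodic_integral_by_parts[of z z' \<phi>' \<phi>''] C2_loopD[OF assms(1)] C2_loopD[OF assms(2)]
  by (subst mean_square_add_scaled) auto

lemma mean_square_tendsto:
  fixes z :: "nat \<Rightarrow> real \<Rightarrow> 'a::euclidean_space"
  assumes "\<And>n. continuous_on UNIV (z n)" "\<And>n s. s \<in> {0..1} \<Longrightarrow> norm (z n s) \<le> B"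
    "\<And>s. s \<in> {0..1} \<Longrightarrow> (\<lambda>n. z n s) \<longlonglongrightarrow> w s" and a: "a \<in> {0..1}"
  shows "(\<lambda>n. integral {0..a} (\<lambda>s. (norm (z n s))\<^sup>2)) \<longlonglongrightarrow> integral {0..a} (\<lambda>s. (norm (w s))\<^sup>2)"
proof (rule dominated_convergence)
  show "(\<lambda>s. (norm (z n s))\<^sup>2) integrable_on {0..a}" for n
    by (intro integrable_unit continuous_intros assms)
  show "(\<lambda>_. B\<^sup>2) integrable_on {0..a}" by (intro integrable_unit continuous_intros)
  show "norm ((norm (z n s))\<^sup>2) \<le> B\<^sup>2" if "s \<in> {0..a}" for n s
    using assms(2)[of s n] that a by (auto intro!: power_mono)
  show "(\<lambda>n. (norm (z n s))\<^sup>2) \<longlonglongrightarrow> (norm (w s))\<^sup>2" if "s \<in> {0..a}" for s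
    using that a by (intro tendsto_intros assms) auto
qed

text \<open>
  The potential and its derivatives are functions on the complex plane, so that the gradient can be multiplied by \<open>cnj z\<close>.
\<close>
locale forced_kepler =
  fixes T C \<alpha> :: real and V Vt :: "real \<Rightarrow> complex \<Rightarrow> real" and Vx :: "real \<Rightarrow> complex \<Rightarrow> complex"
  assumes T_pos: "T > 0" and C_pos: "C > 0" and \<alpha>: "0 < \<alpha>" "\<alpha> < 2"
    and V_deriv: "\<And>p. ((\<lambda>p. V (fst p) (snd p)) has_derivative
          (\<lambda>h. Vt (fst p) (snd p) * fst h + Vx (fst p) (snd p) \<bullet> snd h)) (at p)"
    and cont_Vt: "continuous_on UNIV (\<lambda>p. Vt (fst p) (snd p))"
    and cont_Vx: "continuous_on UNIV (\<lambda>p. Vx (fst p) (snd p))"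
    and V_periodic: "\<And>t x. V (t + T) x = V t x"
    and V_growth: "\<And>t x. \<bar>V t x\<bar> \<le> C * (1 + norm x powr \<alpha>)"
begin

lemma cont_V: "continuous_on UNIV (\<lambda>p. V (fst p) (snd p))"
  by (rule continuous_at_imp_continuous_on) (blast intro: has_derivative_continuous V_deriv)

lemma continuous_on_V [continuous_intros]:
  "continuous_on S f \<Longrightarrow> continuous_on S g \<Longrightarrow> continuous_on S (\<lambda>s. V (f s) (g s))"
  using continuous_on_compose2[OF cont_V, of S "\<lambda>s. (f s, g s)"] by (simp add: continuous_intros)

lemma continuous_on_Vt [continuous_intros]:
  "continuous_on S f \<Longrightarrow> continuous_on S g \<Longrightarrow> continuous_on S (\<lambda>s. Vt (f s) (g s))"
  using continuous_on_compose2[OF cont_Vt, of S "\<lambda>s. (f s, g s)"] by (simp add: continuous_intros)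

lemma continuous_on_Vx [continuous_intros]:
  "continuous_on S f \<Longrightarrow> continuous_on S g \<Longrightarrow> continuous_on S (\<lambda>s. Vx (f s) (g s))"
  using continuous_on_compose2[OF cont_Vx, of S "\<lambda>s. (f s, g s)"] by (simp add: continuous_intros)

lemma tendsto_V:
  assumes "(f \<longlongrightarrow> a) F" "(g \<longlongrightarrow> b) F"
  shows "((\<lambda>s. V (f s) (g s)) \<longlongrightarrow> V a b) F"
proof -
  have "isCont (\<lambda>p. V (fst p) (snd p)) (a, b)"
    using cont_V by (simp add: continuous_on_eq_continuous_at)
  from isCont_tendsto_compose[OF this tendsto_Pair[OF assms]] show ?thesis by simp
qed

text \<open>
  The physical time at parameter \<open>s\<close>. The factor in front of the primitive normalises the total duration to \<open>T\<close>.
\<close>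
definition clock :: "(real \<Rightarrow> complex) \<Rightarrow> real \<Rightarrow> real \<Rightarrow> real" where
  "clock z \<tau> s = \<tau> + T / mean_square z * primitive (\<lambda>s. (norm (z s))\<^sup>2) s"

definition potential :: "(real \<Rightarrow> complex) \<Rightarrow> real \<Rightarrow> real" where
  "potential z \<tau> = integral {0..1} (\<lambda>s. (norm (z s))\<^sup>2 * V (clock z \<tau> s) ((z s)\<^sup>2))"

text \<open>
  The action of the loop \<open>z\<^sup>2\<close> run through in the time given by \<open>clock\<close>. The energy is a separate argument \<open>e\<close>:
  for a limit of curves it is the limit of their energies, which need not be the mean square of a derivative.
\<close>
definition action :: "(real \<Rightarrow> complex) \<Rightarrow> real \<Rightarrow> real \<Rightarrow> real" where
  "action z \<tau> e = 2 / T * mean_square z * e + T / mean_square z + T / mean_square z * potential z \<tau>"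

lemma continuous_on_clock [continuous_intros]:
  assumes "continuous_on UNIV z" "continuous_on S f"
  shows "continuous_on S (\<lambda>x. clock z \<tau> (f x))"
  unfolding clock_def
  by (intro continuous_intros continuous_on_compose2[OF continuous_on_primitive assms(2)] assms(1)) auto

lemma V_bound_on_loop:
  assumes "(norm w)\<^sup>2 \<le> B"
  shows "\<bar>V t (w\<^sup>2)\<bar> \<le> C * (1 + B powr \<alpha>)"
proof -
  have "norm (w\<^sup>2) powr \<alpha> \<le> B powr \<alpha>"
    using assms \<alpha> by (intro powr_mono2) (auto simp: norm_power)
  then show ?thesis
    using V_growth[of t "w\<^sup>2"] C_pos by (meson add_left_mono mult_left_mono order.trans less_imp_le)
qed

lemma potential_bound:
  assumes z: "continuous_on UNIV z" and B: "\<And>s. s \<in> {0..1} \<Longrightarrow> (norm (z s))\<^sup>2 \<le> B"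
  shows "\<bar>potential z \<tau>\<bar> \<le> mean_square z * (C * (1 + B powr \<alpha>))"
proof -
  have "norm (potential z \<tau>) \<le> integral {0..1} (\<lambda>s. (norm (z s))\<^sup>2 * (C * (1 + B powr \<alpha>)))"
    unfolding potential_def
  proof (rule integral_norm_bound_integral)
    show "norm ((norm (z s))\<^sup>2 * V (clock z \<tau> s) ((z s)\<^sup>2)) \<le> (norm (z s))\<^sup>2 * (C * (1 + B powr \<alpha>))"
      if "s \<in> {0..1}" for s
      using V_bound_on_loop[OF B[OF that]] by (simp add: abs_mult mult_left_mono)
  qed (intro integrable_unit continuous_intros z)+
  then show ?thesis by (simp add: mean_square_def)
qed

text \<open>
  Beyond the threshold \<open>r0 = (a / c) powr (1 / (2 - \<alpha>))\<close> the quadratic term wins.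
\<close>
lemma subquadratic_power:
  fixes a c :: real
  assumes "a > 0" "c > 0"
  obtains K where "\<And>r. r \<ge> 0 \<Longrightarrow> a * r powr \<alpha> \<le> c * r\<^sup>2 + K"
proof
  define r0 where "r0 = (a / c) powr (1 / (2 - \<alpha>))"
  fix r :: real assume r: "r \<ge> 0"
  show "a * r powr \<alpha> \<le> c * r\<^sup>2 + a * r0 powr \<alpha>"
  proof (cases "r \<le> r0")
    case True
    then have "a * r powr \<alpha> \<le> a * r0 powr \<alpha>"
      using assms \<alpha> r by (intro mult_left_mono powr_mono2) auto
    moreover have "0 \<le> c * r\<^sup>2" using assms by simp
    ultimately show ?thesis by linarith
  next
    case False
    have "r0 > 0" using assms by (simp add: r0_def)
    then have r: "r > 0" using False by simp
    have "a / c = r0 powr (2 - \<alpha>)"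
      using assms \<alpha> by (simp add: r0_def powr_powr)
    also have "\<dots> \<le> r powr (2 - \<alpha>)"
      using False \<open>r0 > 0\<close> \<alpha> by (intro powr_mono2) auto
    finally have "a \<le> c * r powr (2 - \<alpha>)" using assms by (simp add: field_simps)
    then have "a * r powr \<alpha> \<le> c * r powr (2 - \<alpha>) * r powr \<alpha>"
      by (intro mult_right_mono) auto
    also have "\<dots> = c * r\<^sup>2"
      using r by (simp add: powr_add[symmetric] mult.assoc)
    finally show ?thesis using assms by (simp add: add_increasing2)
  qed
qed

text \<open>
  Half of the kinetic term \<open>(2 / T) N e\<close> absorbs the potential, because
  \<open>|x| = |z|\<^sup>2 \<le> (5 / 2) sqrt (N e)\<close> and \<open>\<alpha> < 2\<close>.
\<close>
lemma action_coercive: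
  obtains K where "\<And>z z' z'' \<tau>. C2_loop z z' z'' \<Longrightarrow> mean_square z > 0 \<Longrightarrow>
    mean_square z * mean_square z' / T + T / mean_square z \<le> action z \<tau> (mean_square z') + K"
proof -
  have "T * C * (5/2) powr \<alpha> > 0" "1 / T > 0" using T_pos C_pos by simp_all
  from subquadratic_power[OF this] obtain K
    where K: "\<And>r. r \<ge> 0 \<Longrightarrow> T * C * (5/2) powr \<alpha> * r powr \<alpha> \<le> 1 / T * r\<^sup>2 + K" by blast
  show thesis
  proof (rule that[of "T * C + K"])
    fix z z' z'' \<tau> assume loop: "C2_loop z z' z''" and N: "mean_square z > 0"
    note z = C2_loopD[OF loop]
    define r where "r = sqrt (mean_square z * mean_square z')"
    have r: "r \<ge> 0" "r\<^sup>2 = mean_square z * mean_square z'"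
      by (simp_all add: r_def mean_square_nonneg)
    have "\<bar>potential z \<tau>\<bar> \<le> mean_square z * (C * (1 + (5 / 2 * r) powr \<alpha>))"
      unfolding r_def by (rule potential_bound[OF z(6) antiperiodic_interpolation[OF z(1,4,7)]])
    then have "T / mean_square z * \<bar>potential z \<tau>\<bar> \<le> T / mean_square z * (mean_square z * (C * (1 + (5 / 2 * r) powr \<alpha>)))"
      using N T_pos by (intro mult_left_mono) auto
    also have "\<dots> = T * C + T * C * (5/2) powr \<alpha> * r powr \<alpha>"
      using N powr_mult[of "5/2" r \<alpha>] r(1) by (simp add: algebra_simps)
    also have "\<dots> \<le> T * C + (1 / T * r\<^sup>2 + K)"
      using K[OF r(1)] by simp
    finally have "\<bar>T / mean_square z * potential z \<tau>\<bar> \<le> T * C + (1 / T * r\<^sup>2 + K)"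
      using N T_pos by (simp only: abs_mult abs_of_pos divide_pos_pos)
    from abs_le_D2[OF this] show "mean_square z * mean_square z' / T + T / mean_square z \<le> action z \<tau> (mean_square z') + (T * C + K)"
      unfolding action_def r(2)[symmetric] mult.assoc by simp
  qed
qed

lemma V_periodic_int: "V (t + of_int k * T) x = V t x"
proof (induction k rule: int_induct[where k = 0])
  case (step1 i)
  then show ?case using V_periodic[of "t + of_int i * T" x] by (simp add: algebra_simps)
next
  case (step2 i)
  then show ?case using V_periodic[of "t + of_int (i - 1) * T" x] by (simp add: algebra_simps)
qed simp

lemma action_periodic: "action z (\<tau> + of_int k * T) e = action z \<tau> e"
proof -
  have "clock z (\<tau> + of_int k * T) s = clock z \<tau> s + of_int k * T" for s
    by (simp add: clock_def)
  then show ?thesis by (simp add: action_def potential_def V_periodic_int)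
qed

text \<open>
  Dominated convergence applies to every integral in the action, since \<open>z\<close> enters
  only through its values.
\<close>
lemma action_tendsto:
  assumes z: "\<And>n. continuous_on UNIV (z n)" "\<And>n s. s \<in> {0..1} \<Longrightarrow> norm (z n s) \<le> B"
    "\<And>s. s \<in> {0..1} \<Longrightarrow> (\<lambda>n. z n s) \<longlonglongrightarrow> w s" "continuous_on UNIV w"
    and \<tau>: "\<tau> \<longlonglongrightarrow> \<tau>'" and e: "e \<longlonglongrightarrow> e'" and pos: "mean_square w \<noteq> 0"
  shows "(\<lambda>n. action (z n) (\<tau> n) (e n)) \<longlonglongrightarrow> action w \<tau>' e'"
proof -
  have N: "(\<lambda>n. mean_square (z n)) \<longlonglongrightarrow> mean_square w"
    unfolding mean_square_def using mean_square_tendsto[OF z(1-3), of 1] by simp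
  have clock: "(\<lambda>n. clock (z n) (\<tau> n) s) \<longlonglongrightarrow> clock w \<tau>' s" if "s \<in> {0..1}" for s
    unfolding clock_def using that mean_square_tendsto[OF z(1-3), of s]
    by (intro tendsto_intros \<tau> N pos) (auto simp: primitive_nonneg_eq)
  have "(\<lambda>n. potential (z n) (\<tau> n)) \<longlonglongrightarrow> potential w \<tau>'"
    unfolding potential_def
  proof (rule dominated_convergence)
    show "(\<lambda>s. (norm (z n s))\<^sup>2 * V (clock (z n) (\<tau> n) s) ((z n s)\<^sup>2)) integrable_on {0..1}" for n
      by (intro integrable_unit continuous_intros z)
    show "(\<lambda>_::real. B\<^sup>2 * (C * (1 + B\<^sup>2 powr \<alpha>))) integrable_on {0..1}"
      by (rule integrable_unit[OF continuous_on_const])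
    show "norm ((norm (z n s))\<^sup>2 * V (clock (z n) (\<tau> n) s) ((z n s)\<^sup>2)) \<le> B\<^sup>2 * (C * (1 + B\<^sup>2 powr \<alpha>))"
      if "s \<in> {0..1}" for n s
    proof -
      have "(norm (z n s))\<^sup>2 \<le> B\<^sup>2" using z(2)[OF that] by (intro power_mono) auto
      with V_bound_on_loop[OF this] show ?thesis
        unfolding real_norm_def abs_mult by (intro mult_mono) auto
    qed
    show "(\<lambda>n. (norm (z n s))\<^sup>2 * V (clock (z n) (\<tau> n) s) ((z n s)\<^sup>2)) \<longlonglongrightarrow> (norm (w s))\<^sup>2 * V (clock w \<tau>' s) ((w s)\<^sup>2)"
      if "s \<in> {0..1}" for s
      by (intro tendsto_intros tendsto_V clock z that)
  qed
  then show ?thesis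
    unfolding action_def by (intro tendsto_intros N e pos)
qed


text \<open>
  The regularised form of a circular motion; it shows that the class of competitors is not empty.
\<close>
lemma circle_loop:
  "C2_loop (\<lambda>s. cis (pi * s)) (\<lambda>s. \<i> * pi * cis (pi * s)) (\<lambda>s. - (pi\<^sup>2 * cis (pi * s)))"
proof -
  have 1: "((\<lambda>s. cis (pi * s)) has_vector_derivative \<i> * pi * cis (pi * s)) (at s)" for s
    unfolding has_vector_derivative_def
    by (auto intro!: derivative_eq_intros simp: scaleR_conv_of_real)
  have "((\<lambda>s. \<i> * pi * cis (pi * s)) has_vector_derivative \<i> * pi * (\<i> * pi * cis (pi * s))) (at s)" for s
    by (intro derivative_intros 1)
  moreover have "\<i> * pi * (\<i> * pi * cis (pi * s)) = - (pi\<^sup>2 * cis (pi * s))" for s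
    by (simp add: power2_eq_square algebra_simps)
  ultimately show ?thesis
    using 1 unfolding C2_loop_def antiperiodic_def
    by (auto simp: distrib_left cis_mult[symmetric] intro!: continuous_intros)
qed

end

section \<open>Existence of a relaxed minimiser\<close>

lemma antiperiodic_int:
  assumes "antiperiodic z"
  shows "z (s + of_int k) = (if even k then z s else - z s)"
proof (induction k rule: int_induct[where k = 0])
  case (step1 i)
  then show ?case using antiperiodicD[OF assms, of "s + of_int i"] by (auto simp: algebra_simps)
next
  case (step2 i)
  then show ?case using antiperiodicD[OF assms, of "s + of_int (i - 1)"] by (auto simp: algebra_simps split: if_splits)
qed simp

lemma antiperiodic_tendsto_extend:
  assumes "\<And>n. antiperiodic (z n)" and "\<And>s. s \<in> {0..1} \<Longrightarrow> (\<lambda>n. z n s) \<longlonglongrightarrow> g s"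
  obtains w where "antiperiodic w" "\<And>s. (\<lambda>n. z n s) \<longlonglongrightarrow> w s"
proof -
  define w where "w s = (if even \<lfloor>s\<rfloor> then g (frac s) else - g (frac s))" for s
  have "(\<lambda>n. z n s) \<longlonglongrightarrow> w s" for s
  proof -
    have "frac s \<in> {0..1}" using frac_ge_0[of s] frac_lt_1[of s] by simp
    from assms(2)[OF this] have "(\<lambda>n. if even \<lfloor>s\<rfloor> then z n (frac s) else - z n (frac s)) \<longlonglongrightarrow> w s"
      unfolding w_def by (auto intro: tendsto_minus)
    then show ?thesis
      unfolding antiperiodic_int[OF assms(1), symmetric] by (simp add: frac_def)
  qed
  note lim = this
  have "w (s + 1) = - w s" for s
  proof (rule LIMSEQ_unique[OF lim])
    show "(\<lambda>n. z n (s + 1)) \<longlonglongrightarrow> - w s"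
      using tendsto_minus[OF lim[of s]] antiperiodicD[OF assms(1)] by simp
  qed
  then have "antiperiodic w" by (simp add: antiperiodic_def)
  with lim that show thesis by blast
qed

text \<open>
  A bound on the energies gives equicontinuity with exponent one half, and by the Poincare inequality a
  uniform bound. The modulus of continuity passes to the pointwise limit and makes it continuous on the whole line.
\<close>
lemma loops_compactness:
  fixes Y :: "nat \<Rightarrow> real \<Rightarrow> complex"
  assumes loop: "\<And>n. C2_loop (Y n) (Y' n) (Y'' n)" and E: "\<And>n. mean_square (Y' n) \<le> B\<^sup>2" and "B > 0"
  obtains w and k :: "nat \<Rightarrow> nat" where "strict_mono k" "antiperiodic w" "continuous_on UNIV w"
    "\<And>s. (\<lambda>n. Y (k n) s) \<longlonglongrightarrow> w s"
proof -
  note Y = C2_loopD[OF loop]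
  have holder: "norm (Y n b - Y n a) \<le> B * sqrt \<bar>b - a\<bar>" if "\<bar>b - a\<bar> \<le> 1" for a b n
  proof -
    have *: "norm (Y n b - Y n a) \<le> B * sqrt \<bar>b - a\<bar>" if ab: "a \<le> b" "b \<le> a + 1" for a b
    proof -
      have "(norm (Y n b - Y n a))\<^sup>2 \<le> mean_square (Y' n) * (b - a)"
        by (rule antiperiodic_holder_bound[OF Y(1,4,7) ab])
      also have "\<dots> \<le> B\<^sup>2 * (b - a)"
        using E ab by (intro mult_right_mono) auto
      also have "\<dots> = (B * sqrt \<bar>b - a\<bar>)\<^sup>2" using ab by (simp add: power_mult_distrib)
      finally show ?thesis using \<open>B > 0\<close> by (intro power2_le_imp_le[OF _ mult_nonneg_nonneg]) auto
    qed
    show ?thesis using *[of a b] *[of b a] that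
      by (cases "a \<le> b") (auto simp: norm_minus_commute abs_minus_commute)
  qed
  have unif: "\<exists>d>0. \<forall>b. \<bar>b - a\<bar> < d \<longrightarrow> \<bar>b - a\<bar> \<le> 1 \<and> B * sqrt \<bar>b - a\<bar> < e" if "e > 0" for e a
  proof (intro exI conjI allI impI)
    show "min 1 ((e / B)\<^sup>2) > 0" using that \<open>B > 0\<close> by simp
    fix b :: real assume b: "\<bar>b - a\<bar> < min 1 ((e / B)\<^sup>2)"
    then show "\<bar>b - a\<bar> \<le> 1" by simp
    have "sqrt \<bar>b - a\<bar> < e / B" using b that \<open>B > 0\<close> by (intro real_less_lsqrt) auto
    then show "B * sqrt \<bar>b - a\<bar> < e" using \<open>B > 0\<close> by (simp add: field_simps)
  qed
  have sup: "norm (Y n s) \<le> B" for n s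
  proof -
    have "4 * (norm (Y n s))\<^sup>2 \<le> B\<^sup>2" by (rule order_trans[OF antiperiodic_poincare[OF Y(1,4,7)] E])
    then have "(norm (Y n s))\<^sup>2 \<le> B\<^sup>2" using zero_le_power2[of "norm (Y n s)"] by linarith
    from power2_le_imp_le[OF this less_imp_le[OF \<open>B > 0\<close>]] show ?thesis .
  qed
  obtain g and k :: "nat \<Rightarrow> nat" where k: "strict_mono k"
    and conv: "\<And>e. 0 < e \<Longrightarrow> \<exists>N. \<forall>n x. n \<ge> N \<and> x \<in> {0..1} \<longrightarrow> norm (Y (k n) x - g x) < e"
  proof (rule Arzela_Ascoli[of "{0..1::real}" Y B])
    fix x e :: real assume "x \<in> {0..1}" "e > 0"
    obtain d where d: "d > 0" "\<And>b. \<bar>b - x\<bar> < d \<Longrightarrow> \<bar>b - x\<bar> \<le> 1 \<and> B * sqrt \<bar>b - x\<bar> < e"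
      using unif[OF \<open>e > 0\<close>, of x] by blast
    have "norm (Y n x - Y n y) < e" if "norm (x - y) < d" for n y
    proof -
      have xy: "\<bar>y - x\<bar> < d" using that by (simp add: abs_minus_commute)
      show ?thesis
        using holder[of y x n] d(2)[OF xy] by (simp add: norm_minus_commute)
    qed
    then show "\<exists>d>0. \<forall>n y. y \<in> {0..1} \<and> norm (x - y) < d \<longrightarrow> norm (Y n x - Y n y) < e"
      using d(1) by blast
  qed (use sup in auto)
  have "(\<lambda>n. Y (k n) s) \<longlonglongrightarrow> g s" if "s \<in> {0..1}" for s
    unfolding LIMSEQ_iff using conv that by blast
  from antiperiodic_tendsto_extend[of "\<lambda>n. Y (k n)", OF Y(1) this]
  obtain w where w: "antiperiodic w" "\<And>s. (\<lambda>n. Y (k n) s) \<longlonglongrightarrow> w s" by blast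
  have holder_w: "norm (w b - w a) \<le> B * sqrt \<bar>b - a\<bar>" if "\<bar>b - a\<bar> \<le> 1" for a b
    using holder[OF that] by (intro LIMSEQ_le_const2[OF tendsto_norm[OF tendsto_diff[OF w(2) w(2)]]]) auto
  have "continuous_on UNIV w"
    unfolding continuous_on_iff dist_norm
  proof (intro ballI allI impI)
    fix x e :: real assume "e > 0"
    then obtain d where d: "d > 0" "\<And>b. \<bar>b - x\<bar> < d \<Longrightarrow> \<bar>b - x\<bar> \<le> 1 \<and> B * sqrt \<bar>b - x\<bar> < e"
      using unif[of e x] by blast
    have "norm (w y - w x) < e" if "norm (y - x) < d" for y
      using holder_w[of y x] d(2)[of y] that by simp
    then show "\<exists>d>0. \<forall>x'\<in>UNIV. norm (x' - x) < d \<longrightarrow> norm (w x' - w x) < e"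
      using d(1) by blast
  qed
  with w k that show thesis by blast
qed

context forced_kepler
begin

text \<open>
  Starting times may be taken in \<open>{0..T}\<close>, as the potential is \<open>T\<close>-periodic. If \<open>B\<close> bounds
  \<open>N E / T + T / N\<close>, then \<open>N \<ge> T / B\<close> and therefore \<open>E \<le> B\<^sup>2\<close>.
\<close>
lemma minimising_sequence:
  obtains Y Y' Y'' :: "nat \<Rightarrow> real \<Rightarrow> complex" and \<sigma> :: "nat \<Rightarrow> real" and m \<nu> B
  where "\<And>n. C2_loop (Y n) (Y' n) (Y'' n)" "\<And>n. mean_square (Y n) \<ge> \<nu>" "\<nu> > 0"
    "\<And>n. mean_square (Y' n) \<le> B\<^sup>2" "B > 0" "\<And>n. \<sigma> n \<in> {0..T}"
    "(\<lambda>n. action (Y n) (\<sigma> n) (mean_square (Y' n))) \<longlonglongrightarrow> m"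
    "\<And>y y' y'' \<tau>. C2_loop y y' y'' \<Longrightarrow> mean_square y > 0 \<Longrightarrow> m \<le> action y \<tau> (mean_square y')"
proof -
  define A where "A = {action y \<tau> (mean_square y') |y y' y'' \<tau>. C2_loop y y' y'' \<and> mean_square y > 0}"
  obtain K where K: "\<And>z z' z'' \<tau>. C2_loop z z' z'' \<Longrightarrow> mean_square z > 0 \<Longrightarrow>
    mean_square z * mean_square z' / T + T / mean_square z \<le> action z \<tau> (mean_square z') + K"
    using action_coercive by blast
  have "mean_square (\<lambda>s. cis (pi * s)) = 1" by (simp add: mean_square_def)
  then have "A \<noteq> {}" unfolding A_def using circle_loop by (force simp del: cis_conv_exp)
  have "- K \<le> a" if "a \<in> A" for a
  proof -
    from that obtain y y' y'' \<tau> where y: "a = action y \<tau> (mean_square y')" "C2_loop y y' y''" "mean_square y > 0"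
      unfolding A_def by blast
    have "0 \<le> mean_square y * mean_square y' / T + T / mean_square y"
      using y(3) T_pos mean_square_nonneg[of y'] by simp
    with K[OF y(2,3), of \<tau>] y(1) show ?thesis by simp
  qed
  then have bdd: "bdd_below A" by (auto simp: bdd_below_def)
  define m where "m = Inf A"
  have lower: "m \<le> action y \<tau> (mean_square y')" if "C2_loop y y' y''" "mean_square y > 0" for y y' y'' \<tau>
    unfolding m_def using that by (intro cInf_lower bdd) (auto simp: A_def)
  have "\<exists>y y' y'' \<tau>. C2_loop y y' y'' \<and> mean_square y > 0 \<and> \<tau> \<in> {0..T} \<and>
      action y \<tau> (mean_square y') < m + 1 / Suc n" for n
  proof -
    have "Inf A < m + 1 / Suc n" by (simp add: m_def)
    from cInf_lessD[OF \<open>A \<noteq> {}\<close> this] obtain y y' y'' \<tau> where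
      y: "C2_loop y y' y''" "mean_square y > 0" "action y \<tau> (mean_square y') < m + 1 / Suc n"
      unfolding A_def by auto
    \<comment> \<open>the starting time modulo \<open>T\<close>\<close>
    define \<tau>' where "\<tau>' = T * frac (\<tau> / T)"
    have "\<tau>' = \<tau> + of_int (- \<lfloor>\<tau> / T\<rfloor>) * T"
      using T_pos by (simp add: \<tau>'_def frac_def algebra_simps)
    then have "action y \<tau>' (mean_square y') < m + 1 / Suc n"
      using y(3) action_periodic by metis
    moreover have "\<tau>' \<in> {0..T}"
      using T_pos frac_ge_0[of "\<tau> / T"] frac_lt_1[of "\<tau> / T"] by (simp add: \<tau>'_def)
    ultimately show ?thesis using y(1,2) by blast
  qed
  then obtain Y Y' Y'' \<sigma> where Y: "\<And>n. C2_loop (Y n) (Y' n) (Y'' n)" "\<And>n. mean_square (Y n) > 0"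
    "\<And>n. \<sigma> n \<in> {0..T}" "\<And>n. action (Y n) (\<sigma> n) (mean_square (Y' n)) < m + 1 / Suc n"
    by metis
  define B where "B = m + 1 + K"
  have bound: "mean_square (Y n) * mean_square (Y' n) / T + T / mean_square (Y n) \<le> B" for n
  proof -
    have "1 / real (Suc n) \<le> 1" by simp
    then show ?thesis using K[OF Y(1)[of n] Y(2)[of n], of "\<sigma> n"] Y(4)[of n] unfolding B_def by linarith
  qed
  have pos: "T / mean_square (Y n) > 0" "mean_square (Y n) * mean_square (Y' n) / T \<ge> 0" for n
    using Y(2)[of n] T_pos mean_square_nonneg[of "Y' n"] by simp_all
  have le: "T / mean_square (Y n) \<le> B" "mean_square (Y n) * mean_square (Y' n) / T \<le> B" for n
    using bound[of n] pos[of n] by linarith+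
  have "B > 0" using le(1)[of 0] pos(1)[of 0] by linarith
  have N: "T / B \<le> mean_square (Y n)" for n
    using le(1)[of n] Y(2)[of n] \<open>B > 0\<close> by (simp add: pos_divide_le_eq mult.commute)
  have "mean_square (Y' n) \<le> B\<^sup>2" for n
  proof -
    have "T / B * mean_square (Y' n) \<le> mean_square (Y n) * mean_square (Y' n)"
      by (rule mult_right_mono[OF N mean_square_nonneg])
    also have "\<dots> \<le> B * T" using le(2)[of n] T_pos by (simp add: pos_divide_le_eq)
    finally have "mean_square (Y' n) * T \<le> B\<^sup>2 * T" 
      using \<open>B > 0\<close> by (simp add: pos_divide_le_eq power2_eq_square mult.commute mult.left_commute)
    then show ?thesis using T_pos by simp
  qed
  moreover have "(\<lambda>n. action (Y n) (\<sigma> n) (mean_square (Y' n))) \<longlonglongrightarrow> m"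
  proof (rule tendsto_sandwich[OF always_eventually always_eventually])
    show "\<forall>n. m \<le> action (Y n) (\<sigma> n) (mean_square (Y' n))"
      using lower[OF Y(1,2)] by blast
    show "\<forall>n. action (Y n) (\<sigma> n) (mean_square (Y' n)) \<le> m + 1 / Suc n"
      using Y(4) less_imp_le by blast
    show "(\<lambda>n. m + 1 / Suc n) \<longlonglongrightarrow> m"
      using tendsto_add[OF tendsto_const LIMSEQ_inverse_real_of_nat, of m] by (simp add: inverse_eq_divide)
  qed (rule tendsto_const)
  moreover have "T / B > 0" using T_pos \<open>B > 0\<close> by simp
  ultimately show thesis using that[of Y Y' Y'' "T / B" B \<sigma> m] Y(1,3) N \<open>B > 0\<close> lower by blast
qed

lemma inner_integral_tendsto:
  fixes z :: "nat \<Rightarrow> real \<Rightarrow> complex"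
  assumes "\<And>n. continuous_on UNIV (z n)" "\<And>n s. norm (z n s) \<le> B"
    "\<And>s. (\<lambda>n. z n s) \<longlonglongrightarrow> w s" "continuous_on UNIV v"
  shows "(\<lambda>n. integral {0..1} (\<lambda>s. z n s \<bullet> v s)) \<longlonglongrightarrow> integral {0..1} (\<lambda>s. w s \<bullet> v s)"
proof (rule dominated_convergence)
  show "(\<lambda>s. z n s \<bullet> v s) integrable_on {0..1}" for n
    by (intro integrable_unit continuous_intros assms)
  show "(\<lambda>s. B * norm (v s)) integrable_on {0..1}" by (intro integrable_unit continuous_intros assms)
  show "norm (z n s \<bullet> v s) \<le> B * norm (v s)" for n s
    unfolding real_norm_def
    by (rule order_trans[OF Cauchy_Schwarz_ineq2]) (intro mult_right_mono assms norm_ge_zero)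
  show "(\<lambda>n. z n s \<bullet> v s) \<longlonglongrightarrow> w s \<bullet> v s" for s
    by (intro tendsto_intros assms)
qed

text \<open>
  The limit of a minimising sequence. The three inequalities replace the statement that \<open>z\<close> is a minimiser with energy
  \<open>e\<close>, which makes no sense before \<open>z\<close> is known to be differentiable: minimality
  along each variation, lower semicontinuity of the energy in dual form
  (the limit of \<open>\<integral>|z\<^sub>n' - \<phi>'|\<^sup>2 \<ge> 0\<close>), and minimality among \<open>C\<^sup>2\<close> curves.
\<close>
lemma relaxed_minimiser:
  obtains z \<tau> e where "continuous_on UNIV z" "antiperiodic z" "mean_square z > 0"
    "\<And>\<phi> \<phi>' \<phi>'' \<theta> \<epsilon>. C2_loop \<phi> \<phi>' \<phi>'' \<Longrightarrow> mean_square (\<lambda>s. z s + \<epsilon> *\<^sub>R \<phi> s) > 0 \<Longrightarrow>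
      action z \<tau> e \<le> action (\<lambda>s. z s + \<epsilon> *\<^sub>R \<phi> s) (\<tau> + \<epsilon> * \<theta>)
        (e - 2 * \<epsilon> * integral {0..1} (\<lambda>s. z s \<bullet> \<phi>'' s) + \<epsilon>\<^sup>2 * mean_square \<phi>')"
    "\<And>\<phi> \<phi>' \<phi>''. C2_loop \<phi> \<phi>' \<phi>'' \<Longrightarrow>
      0 \<le> e + 2 * integral {0..1} (\<lambda>s. z s \<bullet> \<phi>'' s) + mean_square \<phi>'"
    "\<And>y y' y'' \<sigma>. C2_loop y y' y'' \<Longrightarrow> mean_square y > 0 \<Longrightarrow>
      action z \<tau> e \<le> action y \<sigma> (mean_square y')"
proof -
  obtain Y Y' Y'' \<sigma> m \<nu> B where Y: "\<And>n. C2_loop (Y n) (Y' n) (Y'' n)"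
    and N: "\<And>n. mean_square (Y n) \<ge> \<nu>" "\<nu> > 0"
    and E: "\<And>n. mean_square (Y' n) \<le> B\<^sup>2" and B: "B > 0" and \<sigma>: "\<And>n. \<sigma> n \<in> {0..T}"
    and lim: "(\<lambda>n. action (Y n) (\<sigma> n) (mean_square (Y' n))) \<longlonglongrightarrow> m"
    and lower: "\<And>y y' y'' \<tau>. C2_loop y y' y'' \<Longrightarrow> mean_square y > 0 \<Longrightarrow> m \<le> action y \<tau> (mean_square y')"
    by (rule minimising_sequence) blast
  obtain w k where k: "strict_mono k" and w: "antiperiodic w" "continuous_on UNIV w"
    "\<And>s. (\<lambda>n. Y (k n) s) \<longlonglongrightarrow> w s"
    by (rule loops_compactness[where Y = Y and Y' = Y' and Y'' = Y'' and B = B, OF Y E B]) blast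
  define f where "f n = (\<sigma> (k n), mean_square (Y' (k n)))" for n
  have f: "\<forall>n. f n \<in> {0..T} \<times> {0..B\<^sup>2}"
    using \<sigma> E mean_square_nonneg by (auto simp: f_def)
  have compact: "seq_compact ({0..T} \<times> {0..B\<^sup>2})"
    by (intro compact_imp_seq_compact compact_Times compact_Icc)
  obtain l r where r: "strict_mono (r :: nat \<Rightarrow> nat)" and l: "(f \<circ> r) \<longlonglongrightarrow> l"
    by (rule seq_compactE[OF compact f])
  define z where "z n = Y (k (r n))" for n
  define z' where "z' n = Y' (k (r n))" for n
  define z'' where "z'' n = Y'' (k (r n))" for n
  define \<tau> where "\<tau> n = \<sigma> (k (r n))" for n
  have loop: "C2_loop (z n) (z' n) (z'' n)" for n by (simp add: z_def z'_def z''_def Y)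
  note zD = C2_loopD[OF loop]
  have z_lim: "(\<lambda>n. z n s) \<longlonglongrightarrow> w s" for s
    using LIMSEQ_subseq_LIMSEQ[OF w(3) r] by (simp add: o_def z_def)
  have \<tau>_lim: "\<tau> \<longlonglongrightarrow> fst l" and e_lim: "(\<lambda>n. mean_square (z' n)) \<longlonglongrightarrow> snd l"
    using tendsto_fst[OF l] tendsto_snd[OF l] by (simp_all add: o_def f_def \<tau>_def[abs_def] z'_def)
  have z_le: "norm (z n s) \<le> B" for n s
  proof -
    have "4 * (norm (z n s))\<^sup>2 \<le> B\<^sup>2"
      using order_trans[OF antiperiodic_poincare[OF zD(1,4,7)] E[of "k (r n)", folded z'_def]] .
    then have "(norm (z n s))\<^sup>2 \<le> B\<^sup>2" using zero_le_power2[of "norm (z n s)"] by linarith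
    from power2_le_imp_le[OF this less_imp_le[OF B]] show ?thesis .
  qed
  have "(\<lambda>n. mean_square (z n)) \<longlonglongrightarrow> mean_square w"
    unfolding mean_square_def using mean_square_tendsto[OF zD(6) z_le z_lim, of 1] by simp
  then have "\<nu> \<le> mean_square w"
    using N(1) by (intro LIMSEQ_le_const) (auto simp: z_def)
  then have w_pos: "mean_square w > 0" using N(2) by simp
  have "(\<lambda>n. action (z n) (\<tau> n) (mean_square (z' n))) \<longlonglongrightarrow> action w (fst l) (snd l)"
    by (rule action_tendsto[OF zD(6) z_le z_lim w(2) \<tau>_lim e_lim]) (use w_pos in auto)
  moreover have "(\<lambda>n. action (z n) (\<tau> n) (mean_square (z' n))) \<longlonglongrightarrow> m"
    using LIMSEQ_subseq_LIMSEQ[OF LIMSEQ_subseq_LIMSEQ[OF lim k] r] by (simp add: o_def z_def \<tau>_def z'_def)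
  ultimately have m: "action w (fst l) (snd l) = m" by (rule LIMSEQ_unique)
  have e_lim': "(\<lambda>n. mean_square (\<lambda>s. z' n s + \<epsilon> *\<^sub>R \<phi>' s)) \<longlonglongrightarrow>
      snd l - 2 * \<epsilon> * integral {0..1} (\<lambda>s. w s \<bullet> \<phi>'' s) + \<epsilon>\<^sup>2 * mean_square \<phi>'"
    if "C2_loop \<phi> \<phi>' \<phi>''" for \<phi> \<phi>' \<phi>'' \<epsilon>
    unfolding energy_add_scaled[OF loop that]
    by (intro tendsto_intros e_lim inner_integral_tendsto[OF zD(6) z_le z_lim] C2_loopD(8)[OF that])
  show thesis
  proof (rule that[of w "fst l" "snd l"])
    fix \<phi> \<phi>' \<phi>'' \<theta> \<epsilon>
    assume \<phi>: "C2_loop \<phi> \<phi>' \<phi>''" and pos: "mean_square (\<lambda>s. w s + \<epsilon> *\<^sub>R \<phi> s) > 0"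
    note \<phi>D = C2_loopD[OF \<phi>]
    have le: "norm (z n s + \<epsilon> *\<^sub>R \<phi> s) \<le> B + \<bar>\<epsilon>\<bar> * sqrt (mean_square \<phi>')" for n s
    proof -
      have "(norm (\<phi> s))\<^sup>2 \<le> mean_square \<phi>'"
        using antiperiodic_poincare[OF \<phi>D(1,4,7), of s] zero_le_power2[of "norm (\<phi> s)"] by linarith
      then have "norm (\<phi> s) \<le> sqrt (mean_square \<phi>')" by (rule real_le_rsqrt)
      then have "norm (\<epsilon> *\<^sub>R \<phi> s) \<le> \<bar>\<epsilon>\<bar> * sqrt (mean_square \<phi>')" by (simp add: mult_left_mono)
      then show ?thesis using z_le[of n s] norm_triangle_ineq[of "z n s" "\<epsilon> *\<^sub>R \<phi> s"] by linarith
    qed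
    have lim: "(\<lambda>n. z n s + \<epsilon> *\<^sub>R \<phi> s) \<longlonglongrightarrow> w s + \<epsilon> *\<^sub>R \<phi> s" for s
      by (intro tendsto_intros z_lim)
    have cont: "continuous_on UNIV (\<lambda>s. z n s + \<epsilon> *\<^sub>R \<phi> s)" "continuous_on UNIV (\<lambda>s. w s + \<epsilon> *\<^sub>R \<phi> s)" for n
      by (intro continuous_intros zD \<phi>D w)+
    have "(\<lambda>n. mean_square (\<lambda>s. z n s + \<epsilon> *\<^sub>R \<phi> s)) \<longlonglongrightarrow> mean_square (\<lambda>s. w s + \<epsilon> *\<^sub>R \<phi> s)"
      unfolding mean_square_def using mean_square_tendsto[OF cont(1) le lim, of 1] by simp
    from order_tendstoD(1)[OF this pos]
    have "\<forall>\<^sub>F n in sequentially. m \<le> action (\<lambda>s. z n s + \<epsilon> *\<^sub>R \<phi> s) (\<tau> n + \<epsilon> * \<theta>) (mean_square (\<lambda>s. z' n s + \<epsilon> *\<^sub>R \<phi>' s))"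
      by eventually_elim (rule lower[OF C2_loop_add_scaled[OF loop \<phi>]])
    moreover have "(\<lambda>n. action (\<lambda>s. z n s + \<epsilon> *\<^sub>R \<phi> s) (\<tau> n + \<epsilon> * \<theta>) (mean_square (\<lambda>s. z' n s + \<epsilon> *\<^sub>R \<phi>' s))) \<longlonglongrightarrow>
       action (\<lambda>s. w s + \<epsilon> *\<^sub>R \<phi> s) (fst l + \<epsilon> * \<theta>)
        (snd l - 2 * \<epsilon> * integral {0..1} (\<lambda>s. w s \<bullet> \<phi>'' s) + \<epsilon>\<^sup>2 * mean_square \<phi>')"
      by (rule action_tendsto[OF cont(1) le lim cont(2) tendsto_add[OF \<tau>_lim tendsto_const] e_lim'[OF \<phi>]]) (use pos in auto)
    ultimately show "action w (fst l) (snd l) \<le> action (\<lambda>s. w s + \<epsilon> *\<^sub>R \<phi> s) (fst l + \<epsilon> * \<theta>)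
        (snd l - 2 * \<epsilon> * integral {0..1} (\<lambda>s. w s \<bullet> \<phi>'' s) + \<epsilon>\<^sup>2 * mean_square \<phi>')"
      unfolding m by (intro tendsto_lowerbound[where F = sequentially]) auto
  next
    fix \<phi> \<phi>' \<phi>'' assume \<phi>: "C2_loop \<phi> \<phi>' \<phi>''"
    show "0 \<le> snd l + 2 * integral {0..1} (\<lambda>s. w s \<bullet> \<phi>'' s) + mean_square \<phi>'"
      using tendsto_lowerbound[OF e_lim'[OF \<phi>, of "-1"] always_eventually[OF allI[OF mean_square_nonneg]]] by simp
  qed (use w w_pos lower m in auto)
qed

end

section \<open>First variation and regularity\<close>

lemma primitive_by_parts:
  fixes f g :: "real \<Rightarrow> real"
  assumes f: "continuous_on UNIV f" and g: "continuous_on UNIV g" and "primitive f 1 = 0"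
  shows "integral {0..1} (\<lambda>s. f s * primitive g s) = - integral {0..1} (\<lambda>s. primitive f s * g s)"
proof -
  have "((\<lambda>s. primitive f s * primitive g s) has_vector_derivative (f s * primitive g s + primitive f s * g s)) (at s)" for s
    unfolding has_real_derivative_iff_has_vector_derivative[symmetric]
    by (auto intro!: derivative_eq_intros primitive_has_real_derivative f g)
  from integral_of_vector_derivative[OF this]
  have "integral {0..1} (\<lambda>s. f s * primitive g s + primitive f s * g s) = 0"
    using assms(3) by simp
  then show ?thesis
    by (subst (asm) integral_add) (auto intro!: integrable_unit continuous_intros continuous_on_primitive f g)
qed

context forced_kepler
begin

lemma V_chain:
  assumes "(f has_real_derivative f') (at s within A)" "(g has_vector_derivative g') (at s within A)"
  shows "((\<lambda>s. V (f s) (g s)) has_real_derivative Vt (f s) (g s) * f' + Vx (f s) (g s) \<bullet> g') (at s within A)"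
proof -
  have "((\<lambda>s. (f s, g s)) has_derivative (\<lambda>h. (h * f', h *\<^sub>R g'))) (at s within A)"
    using assms unfolding has_field_derivative_def has_vector_derivative_def
    by (intro has_derivative_Pair) (simp_all add: mult_commute_abs)
  from has_derivative_compose[OF this V_deriv]
  show ?thesis
    unfolding has_field_derivative_def fst_conv snd_conv
    by (rule has_derivative_eq_rhs) (simp add: fun_eq_iff algebra_simps)
qed

lemma gradient_periodic: "Vt (t + T) x = Vt t x" "Vx (t + T) x = Vx t x"
proof -
  have "((\<lambda>p. V (fst (p + (T, 0))) (snd (p + (T, 0)))) has_derivative
     (\<lambda>h. Vt (t + T) x * fst h + Vx (t + T) x \<bullet> snd h)) (at (t, x))"
    by (rule has_derivative_eq_rhs, rule has_derivative_compose[where f = "\<lambda>p. p + (T, 0)", OF _ V_deriv])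
      (auto intro!: derivative_eq_intros)
  then have "((\<lambda>p. V (fst p) (snd p)) has_derivative
     (\<lambda>h. Vt (t + T) x * fst h + Vx (t + T) x \<bullet> snd h)) (at (t, x))"
    by (simp add: V_periodic)
  from has_derivative_unique[OF this V_deriv]
  have *: "Vt (t + T) x * fst h + Vx (t + T) x \<bullet> snd h = Vt t x * fst h + Vx t x \<bullet> snd h" for h
    by (simp add: fun_eq_iff)
  show "Vt (t + T) x = Vt t x" using *[of "(1, 0)"] by simp
  have "Vx (t + T) x \<bullet> v = Vx t x \<bullet> v" for v using *[of "(0, v)"] by simp
  then show "Vx (t + T) x = Vx t x" using vector_eq_rdot by blast
qed

end

text \<open>
  A curve as provided by \<open>relaxed_minimiser\<close>.
\<close>
locale relaxed_minimising_loop = forced_kepler +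
  fixes z :: "real \<Rightarrow> complex" and \<tau> e :: real
  assumes cont_z: "continuous_on UNIV z" and anti_z: "antiperiodic z" and N_pos: "mean_square z > 0"
    and relaxed_min: "\<And>\<phi> \<phi>' \<phi>'' \<theta> \<epsilon>. C2_loop \<phi> \<phi>' \<phi>'' \<Longrightarrow> mean_square (\<lambda>s. z s + \<epsilon> *\<^sub>R \<phi> s) > 0 \<Longrightarrow>
      action z \<tau> e \<le> action (\<lambda>s. z s + \<epsilon> *\<^sub>R \<phi> s) (\<tau> + \<epsilon> * \<theta>)
        (e - 2 * \<epsilon> * integral {0..1} (\<lambda>s. z s \<bullet> \<phi>'' s) + \<epsilon>\<^sup>2 * mean_square \<phi>')"
    and energy_lower: "\<And>\<phi> \<phi>' \<phi>''. C2_loop \<phi> \<phi>' \<phi>'' \<Longrightarrow>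
      0 \<le> e + 2 * integral {0..1} (\<lambda>s. z s \<bullet> \<phi>'' s) + mean_square \<phi>'"
    and action_min: "\<And>y y' y'' \<sigma>. C2_loop y y' y'' \<Longrightarrow> mean_square y > 0 \<Longrightarrow>
      action z \<tau> e \<le> action y \<sigma> (mean_square y')"
begin

abbreviation "N \<equiv> mean_square z"
abbreviation "Q \<equiv> potential z \<tau>"
definition m :: "real \<Rightarrow> real" where "m s = (norm (z s))\<^sup>2"
definition M :: "real \<Rightarrow> real" where "M = primitive m"
definition t :: "real \<Rightarrow> real" where "t s = clock z \<tau> s"
definition S :: real where "S = T / N"

lemma S_pos: "S > 0" using T_pos N_pos by (simp add: S_def)

lemma t_eq: "t s = \<tau> + S * M s"
  by (simp add: t_def clock_def S_def M_def m_def[abs_def])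

lemma cont_z_compose [continuous_intros]: "continuous_on A f \<Longrightarrow> continuous_on A (\<lambda>x. z (f x))"
  by (rule continuous_on_compose2[OF cont_z]) auto

lemma cont_m [continuous_intros]: "continuous_on A f \<Longrightarrow> continuous_on A (\<lambda>x. m (f x))"
  unfolding m_def by (intro continuous_intros)

lemma cont_M [continuous_intros]: "continuous_on A f \<Longrightarrow> continuous_on A (\<lambda>x. M (f x))"
  unfolding M_def by (intro continuous_on_primitive_compose cont_m continuous_on_id)

lemma cont_t [continuous_intros]: "continuous_on A f \<Longrightarrow> continuous_on A (\<lambda>x. t (f x))"
  unfolding t_eq by (intro continuous_intros)

text \<open>
  The derivative at \<open>\<epsilon> = 0\<close> of the action along \<open>z + \<epsilon> \<phi>\<close> and \<open>\<tau> + \<epsilon> \<theta>\<close>. The factor of \<open>Vt\<close> is the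
  derivative of the clock, which depends on the whole curve through the normalisation of the period.
\<close>
lemma first_variation:
  assumes \<phi>: "C2_loop \<phi> \<phi>' \<phi>''"
  defines "A \<equiv> integral {0..1} (\<lambda>s. z s \<bullet> \<phi> s)" and "M1 \<equiv> primitive (\<lambda>s. z s \<bullet> \<phi> s)"
  shows "2 / T * (2 * A * e - 2 * N * integral {0..1} (\<lambda>s. z s \<bullet> \<phi>'' s)) - 2 * A * T / N\<^sup>2 * (1 + Q)
     + T / N * integral {0..1} (\<lambda>s. 2 * (z s \<bullet> \<phi> s) * V (t s) ((z s)\<^sup>2)
         + m s * (Vt (t s) ((z s)\<^sup>2) * (\<theta> + T * (2 * M1 s * N - M s * (2 * A)) / N\<^sup>2)
                  + Vx (t s) ((z s)\<^sup>2) \<bullet> (2 * z s * \<phi> s))) = 0"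
    (is "?lhs = 0")
proof -
  note \<phi>D = C2_loopD[OF \<phi>]
  have [continuous_intros]: "continuous_on B f \<Longrightarrow> continuous_on B (\<lambda>x. \<phi> (f x))" for B :: "'z::topological_space set" and f
    by (rule continuous_on_compose2[OF \<phi>D(6)]) auto
  define D where "D = mean_square \<phi>"
  define M2 where "M2 = primitive (\<lambda>s. (norm (\<phi> s))\<^sup>2)"
  define I where "I = integral {0..1} (\<lambda>s. z s \<bullet> \<phi>'' s)"
  define n where "n \<epsilon> = N + 2 * \<epsilon> * A + \<epsilon>\<^sup>2 * D" for \<epsilon>
  have n_eq: "mean_square (\<lambda>s. z s + \<epsilon> *\<^sub>R \<phi> s) = n \<epsilon>" for \<epsilon>
    unfolding n_def A_def D_def by (rule mean_square_add_scaled[OF cont_z \<phi>D(6)])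
  have "isCont n 0" unfolding n_def[abs_def] by (intro continuous_intros)
  then have "(n \<longlongrightarrow> n 0) (nhds 0)"
    unfolding isCont_def by (simp only: tendsto_at_iff_tendsto_nhds)
  moreover have "n 0 > 0" using N_pos by (simp add: n_def)
  ultimately have "\<forall>\<^sub>F \<epsilon> in nhds 0. n \<epsilon> > 0" by (rule order_tendstoD(1))
  then obtain d where d: "d > 0" "\<And>\<epsilon>. \<bar>\<epsilon>\<bar> < d \<Longrightarrow> n \<epsilon> > 0"
    unfolding eventually_nhds_metric by (auto simp: dist_real_def)
  \<comment> \<open>a neighbourhood of \<open>0\<close> on which the perturbed curve is not identically zero, so that its clock is differentiable in \<open>\<epsilon>\<close>\<close>
  define U where "U = {-d<..<d}"
  have U: "0 \<in> U" "convex U" "open U" and n_pos: "\<And>\<epsilon>. \<epsilon> \<in> U \<Longrightarrow> n \<epsilon> > 0"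
    using d by (auto simp: U_def)
  have n_deriv: "(n has_real_derivative 2 * A + 2 * \<epsilon> * D) (at \<epsilon> within B)" for \<epsilon> B
    unfolding n_def[abs_def] by (auto intro!: derivative_eq_intros)
  define p where "p \<epsilon> s = M s + 2 * \<epsilon> * M1 s + \<epsilon>\<^sup>2 * M2 s" for \<epsilon> s
  \<comment> \<open>the clock of the perturbed curve, and its derivative in \<open>\<epsilon>\<close>\<close>
  define c where "c \<epsilon> s = \<tau> + \<epsilon> * \<theta> + T * p \<epsilon> s / n \<epsilon>" for \<epsilon> s
  define c' where "c' \<epsilon> s = \<theta> + T * ((2 * M1 s + 2 * \<epsilon> * M2 s) * n \<epsilon> - p \<epsilon> s * (2 * A + 2 * \<epsilon> * D)) / (n \<epsilon>)\<^sup>2" for \<epsilon> s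
  have clock_eq: "clock (\<lambda>s. z s + \<epsilon> *\<^sub>R \<phi> s) (\<tau> + \<epsilon> * \<theta>) s = c \<epsilon> s" for \<epsilon> s
    unfolding clock_def n_eq c_def p_def M_def M1_def M2_def m_def[abs_def]
    by (simp add: primitive_add_scaled_square[OF cont_z \<phi>D(6)])
  have c_deriv: "((\<lambda>\<epsilon>. c \<epsilon> s) has_real_derivative c' \<epsilon> s) (at \<epsilon> within U)" if "\<epsilon> \<in> U" for \<epsilon> s
    unfolding c_def c'_def p_def using n_pos[OF that]
    by (auto intro!: derivative_eq_intros n_deriv simp: power2_eq_square) (simp add: algebra_simps)
  define a where "a \<epsilon> s = m s + 2 * \<epsilon> * (z s \<bullet> \<phi> s) + \<epsilon>\<^sup>2 * (norm (\<phi> s))\<^sup>2" for \<epsilon> s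
  have a_eq: "(norm (z s + \<epsilon> *\<^sub>R \<phi> s))\<^sup>2 = a \<epsilon> s" for \<epsilon> s
    unfolding a_def m_def by (rule norm_add_scaled_square)
  define a' where "a' \<epsilon> s = 2 * (z s \<bullet> \<phi> s) + 2 * \<epsilon> * (norm (\<phi> s))\<^sup>2" for \<epsilon> s
  have a_deriv: "((\<lambda>\<epsilon>. a \<epsilon> s) has_real_derivative a' \<epsilon> s) (at \<epsilon> within B)" for \<epsilon> s B
    unfolding a_def a'_def by (auto intro!: derivative_eq_intros)
  define x where "x \<epsilon> s = (z s + \<epsilon> *\<^sub>R \<phi> s)\<^sup>2" for \<epsilon> s
  define x' where "x' \<epsilon> s = 2 * (z s + \<epsilon> *\<^sub>R \<phi> s) * \<phi> s" for \<epsilon> s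
  have x_deriv: "((\<lambda>\<epsilon>. x \<epsilon> s) has_vector_derivative x' \<epsilon> s) (at \<epsilon> within B)" for \<epsilon> s B
    unfolding x_def x'_def has_vector_derivative_def
    by (auto intro!: derivative_eq_intros simp: scaleR_conv_of_real)
  define q where "q \<epsilon> s = a \<epsilon> s * V (c \<epsilon> s) (x \<epsilon> s)" for \<epsilon> s
  define q' where "q' \<epsilon> s = a' \<epsilon> s * V (c \<epsilon> s) (x \<epsilon> s)
      + a \<epsilon> s * (Vt (c \<epsilon> s) (x \<epsilon> s) * c' \<epsilon> s + Vx (c \<epsilon> s) (x \<epsilon> s) \<bullet> x' \<epsilon> s)" for \<epsilon> s
  have q_deriv: "((\<lambda>\<epsilon>. q \<epsilon> s) has_real_derivative q' \<epsilon> s) (at \<epsilon> within U)" if "\<epsilon> \<in> U" for \<epsilon> s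
    unfolding q_def q'_def
    by (rule DERIV_cong[OF DERIV_mult[OF a_deriv V_chain[OF c_deriv[OF that] x_deriv]]]) (simp add: algebra_simps)
  have contM1 [continuous_intros]: "continuous_on B f \<Longrightarrow> continuous_on B (\<lambda>x. M1 (f x))"
    and contM2 [continuous_intros]: "continuous_on B f \<Longrightarrow> continuous_on B (\<lambda>x. M2 (f x))"
    for B :: "'z::topological_space set" and f
    unfolding M1_def M2_def by (intro continuous_on_primitive_compose continuous_intros; assumption)+
  have q_cont: "continuous_on UNIV (q \<epsilon>)" if "\<epsilon> \<in> U" for \<epsilon>
    unfolding q_def a_def c_def p_def x_def using n_pos[OF that] by (intro continuous_intros) auto
  have q'_cont: "continuous_on (U \<times> cbox 0 1) (\<lambda>(\<epsilon>, s). q' \<epsilon> s)"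
    unfolding q'_def a_def a'_def c_def c'_def p_def x_def x'_def n_def case_prod_beta
    using n_pos by (intro continuous_intros) (auto simp: n_def dest!: n_pos)
  have "((\<lambda>\<epsilon>. integral (cbox 0 1) (q \<epsilon>)) has_field_derivative integral (cbox 0 1) (q' 0)) (at 0 within U)"
    using q_cont U by (intro leibniz_rule_field_derivative q_deriv q'_cont) (auto intro: integrable_unit)
  then have pot_deriv: "((\<lambda>\<epsilon>. integral {0..1} (q \<epsilon>)) has_real_derivative integral {0..1} (q' 0)) (at 0)"
    by (simp only: at_within_open[OF U(1,3)] cbox_interval)
  define j where "j \<epsilon> = 2 / T * n \<epsilon> * (e - 2 * \<epsilon> * I + \<epsilon>\<^sup>2 * mean_square \<phi>') + T / n \<epsilon> + T / n \<epsilon> * integral {0..1} (q \<epsilon>)" for \<epsilon>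
  have j_eq: "action (\<lambda>s. z s + \<epsilon> *\<^sub>R \<phi> s) (\<tau> + \<epsilon> * \<theta>) (e - 2 * \<epsilon> * I + \<epsilon>\<^sup>2 * mean_square \<phi>') = j \<epsilon>" for \<epsilon>
    unfolding action_def potential_def clock_eq n_eq a_eq j_def q_def x_def ..
  have q0: "integral {0..1} (q 0) = Q"
    unfolding potential_def q_def a_def x_def c_def p_def n_def clock_def M_def m_def[abs_def] by simp
  have j0: "action z \<tau> e = j 0" using j_eq[of 0] by simp
  have "j 0 \<le> j \<epsilon>" if "\<bar>0 - \<epsilon>\<bar> < d" for \<epsilon>
    using relaxed_min[OF \<phi>, of \<epsilon> \<theta>] d(2)[of \<epsilon>] that unfolding n_eq I_def[symmetric] j_eq j0 by simp
  then have min: "\<forall>\<epsilon>. \<bar>0 - \<epsilon>\<bar> < d \<longrightarrow> j 0 \<le> j \<epsilon>" by blast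
  have inv: "((\<lambda>\<epsilon>. T / n \<epsilon>) has_real_derivative - (T * (2 * A) / N\<^sup>2)) (at 0)"
    using N_pos by (auto intro!: derivative_eq_intros n_deriv simp: n_def power2_eq_square)
  have kin: "((\<lambda>\<epsilon>. 2 / T * n \<epsilon> * (e - 2 * \<epsilon> * I + \<epsilon>\<^sup>2 * mean_square \<phi>')) has_real_derivative
      2 / T * (2 * A * e - 2 * N * I)) (at 0)"
    using T_pos by (auto intro!: derivative_eq_intros n_deriv simp: n_def algebra_simps)
  have "(j has_real_derivative 2 / T * (2 * A * e - 2 * N * I) - 2 * A * T / N\<^sup>2 * (1 + Q)
     + T / N * integral {0..1} (q' 0)) (at 0)"
    unfolding j_def[abs_def]
    by (rule DERIV_cong[OF DERIV_add[OF DERIV_add[OF kin inv] DERIV_mult[OF inv pot_deriv]]])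
      (simp add: n_def q0 algebra_simps add_divide_distrib)
  from DERIV_local_min[OF this d(1) min]
  have "2 / T * (2 * A * e - 2 * N * I) - 2 * A * T / N\<^sup>2 * (1 + Q) + T / N * integral {0..1} (q' 0) = 0" .
  moreover have "q' 0 = (\<lambda>s. 2 * (z s \<bullet> \<phi> s) * V (t s) ((z s)\<^sup>2)
         + m s * (Vt (t s) ((z s)\<^sup>2) * (\<theta> + T * (2 * M1 s * N - M s * (2 * A)) / N\<^sup>2)
                  + Vx (t s) ((z s)\<^sup>2) \<bullet> (2 * z s * \<phi> s)))"
    by (simp add: fun_eq_iff q'_def a_def a'_def x_def x'_def c_def c'_def p_def n_def t_eq S_def)
  ultimately show ?thesis by (simp add: I_def)
qed


text \<open>
  The rate, in the parameter \<open>s\<close> and up to the factor \<open>S\<close>, at which the explicit time dependence of the potential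
  changes the total energy.
\<close>
definition mV :: "real \<Rightarrow> real" where "mV s = m s * Vt (t s) ((z s)\<^sup>2)"
definition P :: "real \<Rightarrow> real" where "P = primitive mV"
text \<open>
  The Lagrange multiplier: it collects all terms of the first variation that are multiples of \<open>\<integral> z \<bullet> \<phi>\<close>.
\<close>
definition K :: real where "K = 2 * e / T - T / N\<^sup>2 * (1 + Q) + S\<^sup>2 / N * integral {0..1} (\<lambda>s. P s * m s)"
text \<open>
  In physical time, the derivative of \<open>w\<close> is the power \<open>\<nabla>V \<bullet> x'\<close> of the perturbing force; \<open>w\<close> is the energy of the
  Kepler problem along the solution (\<open>energy_at\<close>).
\<close>
definition w :: "real \<Rightarrow> real" where "w s = K / S + V (t s) ((z s)\<^sup>2) - S * P s"
definition G :: "real \<Rightarrow> complex" where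
  "G s = (S\<^sup>2 / 2) *\<^sub>R (w s *\<^sub>R z s + m s *\<^sub>R (cnj (z s) * Vx (t s) ((z s)\<^sup>2)))"

lemma cont_mV [continuous_intros]: "continuous_on A f \<Longrightarrow> continuous_on A (\<lambda>x. mV (f x))"
  unfolding mV_def by (intro continuous_intros)

lemma cont_P [continuous_intros]: "continuous_on A f \<Longrightarrow> continuous_on A (\<lambda>x. P (f x))"
  unfolding P_def by (intro continuous_on_primitive_compose cont_mV continuous_on_id)

lemma cont_w [continuous_intros]: "continuous_on A f \<Longrightarrow> continuous_on A (\<lambda>x. w (f x))"
  unfolding w_def using S_pos by (intro continuous_intros) auto

lemma cont_G: "continuous_on UNIV G"
  unfolding G_def[abs_def] by (intro continuous_intros) auto

lemma z_square_periodic: "(z (s + 1))\<^sup>2 = (z s)\<^sup>2" "m (s + 1) = m s"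
  using antiperiodicD[OF anti_z] by (simp_all add: m_def)

lemma M_shift: "M (s + 1) = M s + N"
  unfolding M_def mean_square_eq_primitive m_def[abs_def, symmetric]
  by (intro primitive_shift) (auto intro!: continuous_intros simp: z_square_periodic)

lemma t_shift: "t (s + 1) = t s + T"
proof -
  have "S * N = T" using N_pos by (simp add: S_def)
  then show ?thesis by (simp add: t_eq M_shift distrib_left)
qed

text \<open>
  The variation of the starting time alone. This makes \<open>P\<close> periodic, and hence \<open>w\<close> periodic and
  \<open>G\<close> antiperiodic.
\<close>
lemma P_1: "P 1 = 0"
proof -
  have "C2_loop (\<lambda>_. 0) (\<lambda>_. 0) (\<lambda>_. 0)" by (simp add: C2_loop_def antiperiodic_def)
  from first_variation[OF this, of 1] have "T / N * integral {0..1} mV = 0"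
    by (simp add: primitive_def mV_def[abs_def])
  then show ?thesis using T_pos N_pos by (simp add: P_def primitive_nonneg_eq)
qed

lemma P_shift: "P (s + 1) = P s"
proof -
  have "mV (s + 1) = mV s" for s
    by (simp add: mV_def z_square_periodic t_shift gradient_periodic)
  from primitive_shift[OF cont_mV[OF continuous_on_id] this] show ?thesis
    using P_1 by (simp add: P_def)
qed

lemma w_shift: "w (s + 1) = w s"
  by (simp add: w_def z_square_periodic t_shift P_shift V_periodic)

lemma anti_G: "antiperiodic G"
  unfolding antiperiodic_def
  using antiperiodicD[OF anti_z]
  by (simp add: G_def w_shift z_square_periodic t_shift gradient_periodic scaleR_diff_right scaleR_add_right)

text \<open>
  The nonlocal terms come from the clock. Integration by parts moves the primitives of
  \<open>z \<bullet> \<phi>\<close> and of \<open>|z|\<^sup>2\<close> onto \<open>P\<close>, which vanishes at both ends; this leaves a pointwise density.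
\<close>
lemma euler_lagrange:
  assumes \<phi>: "C2_loop \<phi> \<phi>' \<phi>''"
  shows "integral {0..1} (\<lambda>s. z s \<bullet> \<phi>'' s) = integral {0..1} (\<lambda>s. G s \<bullet> \<phi> s)"
proof -
  note \<phi>D = C2_loopD[OF \<phi>]
  define I where "I = integral {0..1} (\<lambda>s. z s \<bullet> \<phi>'' s)"
  define A where "A = integral {0..1} (\<lambda>s. z s \<bullet> \<phi> s)"
  define M1 where "M1 = primitive (\<lambda>s. z s \<bullet> \<phi> s)"
  define v where "v s = (z s \<bullet> \<phi> s) * V (t s) ((z s)\<^sup>2)" for s
  define x where "x s = m s * ((cnj (z s) * Vx (t s) ((z s)\<^sup>2)) \<bullet> \<phi> s)" for s
  have cont: "continuous_on UNIV v" "continuous_on UNIV x" "continuous_on UNIV M1" "continuous_on UNIV (\<lambda>s. z s \<bullet> \<phi> s)"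
    unfolding v_def[abs_def] x_def[abs_def] M1_def
    by (intro continuous_intros continuous_on_primitive \<phi>D(6))+
  note int = integrable_unit[of _ 0 1]
  have M1: "integral {0..1} (\<lambda>s. mV s * M1 s) = - integral {0..1} (\<lambda>s. P s * (z s \<bullet> \<phi> s))"
    unfolding M1_def P_def
    by (rule primitive_by_parts) (use cont P_1 in \<open>auto intro!: continuous_intros simp: P_def\<close>)
  have M: "integral {0..1} (\<lambda>s. mV s * M s) = - integral {0..1} (\<lambda>s. P s * m s)"
    unfolding M_def P_def
    by (rule primitive_by_parts) (use P_1 in \<open>auto intro!: continuous_intros simp: P_def\<close>)
  define PZ where "PZ = integral {0..1} (\<lambda>s. P s * (z s \<bullet> \<phi> s))"
  define PM where "PM = integral {0..1} (\<lambda>s. P s * m s)"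
  have Vx_inner: "Vx a b \<bullet> (2 * z s * \<phi> s) = 2 * ((cnj (z s) * Vx a b) \<bullet> \<phi> s)" for a b s
    by (simp add: inner_complex_def algebra_simps)
  have "integral {0..1} (\<lambda>s. 2 * (z s \<bullet> \<phi> s) * V (t s) ((z s)\<^sup>2)
         + m s * (Vt (t s) ((z s)\<^sup>2) * (0 + T * (2 * M1 s * N - M s * (2 * A)) / N\<^sup>2)
                  + Vx (t s) ((z s)\<^sup>2) \<bullet> (2 * z s * \<phi> s)))
     = integral {0..1} (\<lambda>s. 2 * v s + ((2 * S) * (mV s * M1 s) - (2 * A * S / N) * (mV s * M s)) + 2 * x s)"
    (is "?J = _")
    using N_pos unfolding Vx_inner
    by (intro integral_cong) (simp add: v_def x_def mV_def S_def field_simps power2_eq_square)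
  also have "\<dots> = 2 * integral {0..1} v + (2 * S * (- PZ) - (2 * A * S / N) * (- PM)) + 2 * integral {0..1} x"
    unfolding PZ_def PM_def M1[symmetric] M[symmetric]
    by (rule integral_unique, intro has_integral_add has_integral_diff has_integral_mult_right
        integrable_integral int cont(1,2) continuous_intros cont(3))
  finally have J: "?J = 2 * integral {0..1} v + (2 * S * (- PZ) - (2 * A * S / N) * (- PM)) + 2 * integral {0..1} x" .
  have "2 / T * (2 * A * e - 2 * N * I) - 2 * A * T / N\<^sup>2 * (1 + Q) + T / N * ?J = 0"
    using first_variation[OF \<phi>, of 0] unfolding I_def A_def M1_def .
  then have EL: "2 / S * I = K * A + S * integral {0..1} v - S\<^sup>2 * PZ + S * integral {0..1} x"
    unfolding J K_def PM_def[symmetric] using T_pos N_pos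
    by (simp add: S_def field_simps power2_eq_square)
  have "integral {0..1} (\<lambda>s. G s \<bullet> \<phi> s)
     = integral {0..1} (\<lambda>s. (S / 2) * (K * (z s \<bullet> \<phi> s) + S * v s - S\<^sup>2 * (P s * (z s \<bullet> \<phi> s)) + S * x s))"
    using S_pos unfolding G_def
    by (intro integral_cong) (simp add: v_def x_def w_def inner_add_left field_simps power2_eq_square)
  also have "\<dots> = (S / 2) * (K * A + S * integral {0..1} v - S\<^sup>2 * PZ + S * integral {0..1} x)"
    unfolding A_def PZ_def
    by (rule integral_unique, intro has_integral_add has_integral_diff has_integral_mult_right
        integrable_integral int cont continuous_on_mult cont_P continuous_on_id)
  also have "\<dots> = I"
    unfolding EL[symmetric] using S_pos by simp
  finally show ?thesis by (simp add: I_def)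
qed

text \<open>
  Let \<open>y\<close> be the antiperiodic solution of \<open>y'' = G\<close>. Then \<open>z - y\<close> is orthogonal to \<open>\<phi>''\<close> for every test function, and
  \<open>z - y\<close> is itself of this form.
\<close>
lemma euler_lagrange_regular:
  obtains z' where "C2_loop z z' G"
proof -
  obtain y' where y': "antiperiodic y'" "\<And>s. (y' has_vector_derivative G s) (at s)"
    using antiperiodic_primitive_exists[OF cont_G anti_G] by blast
  obtain y where y: "antiperiodic y" "\<And>s. (y has_vector_derivative y' s) (at s)"
    using antiperiodic_primitive_exists[OF continuous_on_of_vector_derivative[OF y'(2)] y'(1)] by blast
  have loop: "C2_loop y y' G" using y y' cont_G by (simp add: C2_loop_def)
  note yD = C2_loopD[OF loop]
  define \<psi> where "\<psi> s = z s - y s" for s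
  have \<psi>: "continuous_on UNIV \<psi>" "antiperiodic \<psi>"
    using anti_z y(1) unfolding \<psi>_def[abs_def] by (auto intro!: continuous_intros yD simp: antiperiodic_def)
  \<comment> \<open>the test function is the double antiperiodic primitive of \<open>z - y\<close>\<close>
  obtain \<phi>' where \<phi>': "antiperiodic \<phi>'" "\<And>s. (\<phi>' has_vector_derivative \<psi> s) (at s)"
    using antiperiodic_primitive_exists[OF \<psi>] by blast
  obtain \<phi> where \<phi>: "antiperiodic \<phi>" "\<And>s. (\<phi> has_vector_derivative \<phi>' s) (at s)"
    using antiperiodic_primitive_exists[OF continuous_on_of_vector_derivative[OF \<phi>'(2)] \<phi>'(1)] by blast
  have test: "C2_loop \<phi> \<phi>' \<psi>" using \<phi> \<phi>' \<psi> by (simp add: C2_loop_def)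
  note \<phi>D = C2_loopD[OF test]
  have "integral {0..1} (\<lambda>s. y s \<bullet> \<psi> s) = - integral {0..1} (\<lambda>s. y' s \<bullet> \<phi>' s)"
    by (rule antiperiodic_integral_by_parts[OF yD(1,4,7) \<phi>D(2,5,8)])
  also have "\<dots> = integral {0..1} (\<lambda>s. G s \<bullet> \<phi> s)"
    using antiperiodic_integral_by_parts[OF yD(2,5,8) \<phi>D(1,4,7)] by simp
  also have "\<dots> = integral {0..1} (\<lambda>s. z s \<bullet> \<psi> s)"
    by (rule euler_lagrange[OF test, symmetric])
  finally have "integral {0..1} (\<lambda>s. z s \<bullet> \<psi> s) - integral {0..1} (\<lambda>s. y s \<bullet> \<psi> s) = 0" by simp
  then have "integral {0..1} (\<lambda>s. \<psi> s \<bullet> \<psi> s) = 0"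
    unfolding \<psi>_def inner_diff_left
    by (subst integral_diff) (auto intro!: integrable_unit continuous_intros yD)
  moreover have "continuous_on {0..1} (\<lambda>s. \<psi> s \<bullet> \<psi> s)"
    by (rule continuous_on_subset[OF continuous_on_inner[OF \<psi>(1) \<psi>(1)]]) simp
  ultimately have "\<psi> s \<bullet> \<psi> s = 0" if "s \<in> {0..1}" for s
    using integral_eq_0_iff[of 0 1 "\<lambda>s. \<psi> s \<bullet> \<psi> s"] that inner_ge_zero zero_less_one by blast
  then have "\<psi> s = 0" if "s \<in> {0..1}" for s using that by (simp only: inner_eq_zero_iff)
  moreover have "frac s \<in> {0..1}" for s :: real using frac_ge_0[of s] frac_lt_1[of s] by simp
  ultimately have "\<psi> (frac s + of_int \<lfloor>s\<rfloor>) = 0" for s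
    unfolding antiperiodic_int[OF \<psi>(2)] by simp
  then have "z = y" by (simp add: fun_eq_iff frac_def \<psi>_def)
  then show thesis using loop that by blast
qed

end

section \<open>Energy identity and return to physical time\<close>

lemma has_vector_derivative_quotient:
  fixes f g :: "real \<Rightarrow> 'a::real_normed_field"
  assumes "(f has_vector_derivative f') (at s)" "(g has_vector_derivative g') (at s)" "g s \<noteq> 0"
  shows "((\<lambda>s. f s / g s) has_vector_derivative (f' * g s - f s * g') / (g s)\<^sup>2) (at s)"
  using has_derivative_divide'[OF assms(1,2)[unfolded has_vector_derivative_def] assms(3)]
  unfolding has_vector_derivative_def
  by (rule has_derivative_eq_rhs)
    (use assms(3) in \<open>simp add: fun_eq_iff power2_eq_square scaleR_conv_of_real field_simps\<close>)

lemma has_vector_derivative_difference_quotient: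
  fixes f :: "real \<Rightarrow> 'a::real_normed_vector"
  assumes "(f has_vector_derivative d) (at a)"
  shows "((\<lambda>s. (f s - f a) /\<^sub>R (s - a)) \<longlongrightarrow> d) (at a)"
proof -
  have "((\<lambda>s. norm ((f s - f a) - (s - a) *\<^sub>R d) / norm (s - a)) \<longlongrightarrow> 0) (at a)"
    using assms unfolding has_vector_derivative_def has_derivative_iff_norm by blast
  moreover have "\<forall>\<^sub>F s in at a. norm ((f s - f a) - (s - a) *\<^sub>R d) / norm (s - a) = norm ((f s - f a) /\<^sub>R (s - a) - d)"
    using eventually_neq_at_within[of a]
  proof eventually_elim
    case (elim s)
    then have "(f s - f a) /\<^sub>R (s - a) - d = ((f s - f a) - (s - a) *\<^sub>R d) /\<^sub>R (s - a)"
      by (simp add: scaleR_right_diff_distrib)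
    then show ?case by (simp add: divide_inverse mult.commute)
  qed
  ultimately have "((\<lambda>s. norm ((f s - f a) /\<^sub>R (s - a) - d)) \<longlongrightarrow> 0) (at a)"
    by (rule Lim_transform_eventually)
  then show ?thesis by (metis Lim_null tendsto_norm_zero_iff)
qed

context relaxed_minimising_loop
begin

definition z' :: "real \<Rightarrow> complex" where "z' = (SOME z'. C2_loop z z' G)"

lemma loop: "C2_loop z z' G"
  unfolding z'_def using euler_lagrange_regular by (metis someI_ex)

lemmas zD = C2_loopD[OF loop]

text \<open>
  Testing the dual lower bound with \<open>z\<close> gives one inequality; the other holds as \<open>z\<close> competes with itself
  and the action increases with \<open>e\<close>.
\<close>
lemma energy_eq: "e = mean_square z'"
proof (rule antisym)
  have "action z \<tau> e \<le> action z \<tau> (mean_square z')" by (rule action_min[OF loop N_pos])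
  then show "e \<le> mean_square z'"
    using T_pos N_pos by (simp add: action_def mult_le_cancel_left_pos divide_le_cancel)
  have "integral {0..1} (\<lambda>s. z s \<bullet> G s) = - mean_square z'"
    using antiperiodic_integral_by_parts[OF zD(1,4,7) zD(2,5,8)]
    by (simp add: mean_square_def power2_norm_eq_inner)
  then show "mean_square z' \<le> e" using energy_lower[OF loop] by simp
qed

lemma m_deriv: "(m has_real_derivative 2 * (z s \<bullet> z' s)) (at s)"
  unfolding m_def[abs_def] power2_norm_eq_inner has_real_derivative_iff_has_vector_derivative
  using bounded_bilinear.has_vector_derivative[OF bounded_bilinear_inner zD(4) zD(4), of s]
  by (simp add: inner_commute)

lemma t_deriv: "(t has_real_derivative S * m s) (at s)"
  unfolding t_eq[abs_def] M_def
  using DERIV_add[OF DERIV_const DERIV_cmult[OF primitive_has_real_derivative[OF cont_m[OF continuous_on_id]]]]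
  by simp

lemma z_square_deriv: "((\<lambda>s. (z s)\<^sup>2) has_vector_derivative 2 * z s * z' s) (at s)"
  unfolding power2_eq_square
  using has_vector_derivative_mult[OF zD(4) zD(4), of s] by (simp add: algebra_simps)

lemma w_deriv: "(w has_real_derivative Vx (t s) ((z s)\<^sup>2) \<bullet> (2 * z s * z' s)) (at s)"
proof -
  have "(w has_real_derivative 0 + (Vt (t s) ((z s)\<^sup>2) * (S * m s) + Vx (t s) ((z s)\<^sup>2) \<bullet> (2 * z s * z' s)) - S * mV s) (at s)"
    unfolding w_def[abs_def] P_def
    by (intro DERIV_diff DERIV_add DERIV_const DERIV_cmult V_chain t_deriv z_square_deriv
        primitive_has_real_derivative cont_mV continuous_on_id)
  then show ?thesis by (simp add: mV_def mult_ac)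
qed

text \<open>
  The two sides have the same derivative by \<open>z'' = G\<close>. The constant is found by
  integration: \<open>\<integral> w |z|\<^sup>2 = 2 e / S\<^sup>2 - 1\<close> is what the definition of \<open>K\<close> says.
\<close>
lemma energy_identity: "2 / S\<^sup>2 * (norm (z' s))\<^sup>2 = 1 + w s * m s"
proof -
  define H where "H s = 2 / S\<^sup>2 * (z' s \<bullet> z' s) - w s * m s" for s
  have "(H has_real_derivative 0) (at s)" for s
  proof -
    have kin: "((\<lambda>s. z' s \<bullet> z' s) has_real_derivative 2 * (z' s \<bullet> G s)) (at s)"
      unfolding has_real_derivative_iff_has_vector_derivative
      using bounded_bilinear.has_vector_derivative[OF bounded_bilinear_inner zD(5) zD(5), of s]
      by (simp add: inner_commute)
    have "Vx (t s) ((z s)\<^sup>2) \<bullet> (2 * z s * z' s) = 2 * (z' s \<bullet> (cnj (z s) * Vx (t s) ((z s)\<^sup>2)))"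
      by (simp add: inner_complex_def algebra_simps)
    moreover have "2 / S\<^sup>2 * (2 * (z' s \<bullet> G s))
        = 2 * (w s * (z s \<bullet> z' s) + m s * (z' s \<bullet> (cnj (z s) * Vx (t s) ((z s)\<^sup>2))))"
      using S_pos by (simp add: G_def inner_add_right inner_commute[of "z' s" "z s"])
    ultimately have "2 / S\<^sup>2 * (2 * (z' s \<bullet> G s))
        - (Vx (t s) ((z s)\<^sup>2) \<bullet> (2 * z s * z' s) * m s + 2 * (z s \<bullet> z' s) * w s) = 0"
      by (simp add: algebra_simps)
    with DERIV_diff[OF DERIV_cmult[OF kin, of "2 / S\<^sup>2"] DERIV_mult[OF w_deriv m_deriv]]
    show ?thesis unfolding H_def[abs_def] by simp
  qed
  then have "H s = H 0" for s by (intro DERIV_isconst_all) auto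
  then have const: "H = (\<lambda>_. H 0)" by blast
  define PM where "PM = integral {0..1} (\<lambda>s. P s * m s)"
  note int = integrable_unit[of _ 0 1]
  have "(\<lambda>s. w s * m s) = (\<lambda>s. K / S * m s + m s * V (t s) ((z s)\<^sup>2) - S * (P s * m s))"
    by (simp add: w_def fun_eq_iff algebra_simps)
  moreover have "((\<lambda>s. K / S * m s + m s * V (t s) ((z s)\<^sup>2) - S * (P s * m s)) has_integral
      (K / S * integral {0..1} m + integral {0..1} (\<lambda>s. m s * V (t s) ((z s)\<^sup>2)) - S * PM)) {0..1}"
    unfolding PM_def
    by (intro has_integral_add has_integral_diff has_integral_mult_right integrable_integral int continuous_intros)
  moreover have "integral {0..1} m = N" "integral {0..1} (\<lambda>s. m s * V (t s) ((z s)\<^sup>2)) = Q"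
    by (simp_all add: mean_square_def potential_def m_def[abs_def] t_def)
  moreover have "K / S * N + Q - S * PM = 2 / S\<^sup>2 * e - 1"
    using T_pos N_pos unfolding K_def PM_def[symmetric] by (simp add: S_def field_simps power2_eq_square)
  ultimately have wm: "((\<lambda>s. w s * m s) has_integral 2 / S\<^sup>2 * e - 1) {0..1}" by simp
  have "((\<lambda>s. z' s \<bullet> z' s) has_integral mean_square z') {0..1}"
    unfolding mean_square_def power2_norm_eq_inner
    by (intro integrable_integral int continuous_intros zD)
  then have "((\<lambda>s. z' s \<bullet> z' s) has_integral e) {0..1}"
    by (simp only: energy_eq[symmetric])
  from has_integral_diff[OF has_integral_mult_right[OF this, of "2 / S\<^sup>2"] wm]
  have "(H has_integral 1) {0..1}" by (simp add: H_def[abs_def])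
  moreover have "(H has_integral H 0) {0..1}"
    by (subst const) (use has_integral_const_real[of "H 0" 0 1] in simp)
  ultimately have "H 0 = 1" by (rule has_integral_unique[symmetric])
  with \<open>H s = H 0\<close> show ?thesis by (simp add: H_def power2_norm_eq_inner)
qed

lemma z'_nonzero: "z s = 0 \<Longrightarrow> z' s \<noteq> 0"
  using energy_identity[of s] by (auto simp: m_def)

lemma z_quotient_tendsto:
  assumes "z s0 = 0"
  shows "((\<lambda>s. z s /\<^sub>R (s - s0)) \<longlongrightarrow> z' s0) (at s0)"
  using has_vector_derivative_difference_quotient[OF zD(4)[of s0]] assms by simp

lemma z_eventually_nonzero: "\<forall>\<^sub>F s in at s0. z s \<noteq> 0"
proof (cases "z s0 = 0")
  case True
  from tendsto_imp_eventually_ne[OF z_quotient_tendsto[OF True] z'_nonzero[OF True]]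
  show ?thesis by eventually_elim auto
next
  case False
  have "(z \<longlongrightarrow> z s0) (at s0)"
    using zD(6) by (simp add: continuous_on_eq_continuous_at isCont_def)
  from tendsto_imp_eventually_ne[OF this False] show ?thesis .
qed

text \<open>
  The speed \<open>S |z|\<^sup>2\<close> of the clock vanishes only at isolated points.
\<close>
lemma t_strict_mono: "strict_mono t"
proof (rule strict_monoI)
  fix a b :: real assume ab: "a < b"
  have mono: "t c \<le> t d" if "c \<le> d" for c d
    using t_deriv S_pos that by (intro DERIV_nonneg_imp_nondecreasing[OF that]) (auto simp: m_def intro!: exI)
  show "t a < t b"
  proof (rule ccontr)
    assume "\<not> t a < t b"
    \<comment> \<open>a clock that stops on an interval would make \<open>z\<close> vanish there\<close>
    then have eq: "t s = t a" if "a < s" "s < b" for s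
      using mono[of a s] mono[of s b] mono[of a b] that ab by simp
    have zero: "z s = 0" if s: "s \<in> {a<..<b}" for s
    proof -
      have "((\<lambda>_. t a) has_real_derivative S * m s) (at s)"
        by (rule has_field_derivative_transform_within_open[OF t_deriv open_greaterThanLessThan s]) (use eq in auto)
      then have "S * m s = 0" using DERIV_const DERIV_unique by blast
      then show ?thesis using S_pos by (simp add: m_def)
    qed
    define c where "c = (a + b) / 2"
    have c: "c \<in> {a<..<b}" using ab by (simp add: c_def)
    then have "\<forall>\<^sub>F s in at c. s \<in> {a<..<b}"
      by (intro eventually_at_in_open') auto
    with z_eventually_nonzero[of c] have "\<forall>\<^sub>F s in at c. False"
      by eventually_elim (use zero in blast)
    then show False by simp
  qed
qed

lemma t_shift_int: "t (of_int k) = t 0 + of_int k * T"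
proof (induction k rule: int_induct[where k = 0])
  case (step1 i)
  then show ?case using t_shift[of "of_int i"] by (simp add: algebra_simps)
next
  case (step2 i)
  then show ?case using t_shift[of "of_int (i - 1)"] by (simp add: algebra_simps)
qed simp

lemma t_surj: "surj t"
proof -
  have "\<exists>s. t s = y" for y
  proof -
    define k where "k = \<lfloor>(y - t 0) / T\<rfloor>"
    have "of_int k \<le> (y - t 0) / T" "(y - t 0) / T \<le> of_int (k + 1)"
      unfolding k_def by linarith+
    then have "of_int k * T \<le> y - t 0" "y - t 0 \<le> of_int (k + 1) * T"
      using T_pos by (simp_all only: pos_le_divide_eq pos_divide_le_eq)
    then have "t (of_int k) \<le> y" "y \<le> t (of_int (k + 1))"
      unfolding t_shift_int by linarith+
    then have "\<exists>s\<ge>of_int k. s \<le> of_int (k + 1) \<and> t s = y"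
      by (intro IVT' cont_t continuous_on_id) auto
    then show ?thesis by blast
  qed
  then show ?thesis by (metis surjI)
qed

definition \<sigma> :: "real \<Rightarrow> real" where "\<sigma> = inv t"

lemma t_\<sigma> [simp]: "t (\<sigma> y) = y" and \<sigma>_t [simp]: "\<sigma> (t s) = s"
  using t_surj strict_mono_imp_inj_on[OF t_strict_mono] by (simp_all add: \<sigma>_def surj_f_inv_f)

lemma \<sigma>_shift: "\<sigma> (y + T) = \<sigma> y + 1"
  by (metis \<sigma>_t t_\<sigma> t_shift)

lemma cont_\<sigma>: "continuous_on UNIV \<sigma>"
proof (rule continuous_onI_mono)
  have "\<sigma> ` UNIV = UNIV" by (metis \<sigma>_t surjI)
  then show "open (\<sigma> ` UNIV)" by simp
  show "\<sigma> x \<le> \<sigma> y" if "x \<le> y" for x y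
    using that strict_mono_less_eq[OF t_strict_mono, of "\<sigma> x" "\<sigma> y"] by simp
qed

lemma isCont_\<sigma>: "isCont \<sigma> y"
  using cont_\<sigma> by (simp add: continuous_on_eq_continuous_at)

lemma \<sigma>_at: "filterlim \<sigma> (at (\<sigma> y)) (at y)"
proof (rule filterlim_atI)
  show "(\<sigma> \<longlongrightarrow> \<sigma> y) (at y)" using isCont_\<sigma> by (simp add: isCont_def)
  have "\<sigma> u \<noteq> \<sigma> y" if "u \<noteq> y" for u using that by (metis t_\<sigma>)
  then show "\<forall>\<^sub>F u in at y. \<sigma> u \<noteq> \<sigma> y"
    by (auto simp: eventually_at_filter)
qed

lemma \<sigma>_deriv:
  assumes "z (\<sigma> y) \<noteq> 0"
  shows "(\<sigma> has_vector_derivative inverse (S * m (\<sigma> y))) (at y)"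
  unfolding has_real_derivative_iff_has_vector_derivative[symmetric]
  using assms S_pos
  by (intro DERIV_inverse_function[where f = t and a = "y - 1" and b = "y + 1"] t_deriv isCont_\<sigma>)
    (auto simp: m_def)

definition x :: "real \<Rightarrow> complex" where "x y = (z (\<sigma> y))\<^sup>2"
text \<open>
  The physical velocity \<open>dx / dt = 2 z z' / (S |z|\<^sup>2)\<close>.
\<close>
definition v :: "real \<Rightarrow> complex" where "v y = of_real (2 / S) * (z' (\<sigma> y) / cnj (z (\<sigma> y)))"

lemma m_complex: "complex_of_real (m s) = z s * cnj (z s)"
  unfolding m_def by (rule complex_norm_square)

lemma x_deriv:
  assumes "z (\<sigma> y) \<noteq> 0"
  shows "(x has_vector_derivative v y) (at y)"
proof -
  have "((\<lambda>s. (z s)\<^sup>2) \<circ> \<sigma> has_vector_derivative inverse (S * m (\<sigma> y)) *\<^sub>R (2 * z (\<sigma> y) * z' (\<sigma> y))) (at y)"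
    by (rule vector_diff_chain_at[OF \<sigma>_deriv[OF assms] z_square_deriv])
  moreover have "inverse (S * m (\<sigma> y)) *\<^sub>R (2 * z (\<sigma> y) * z' (\<sigma> y)) = v y"
    using assms S_pos by (simp add: v_def scaleR_conv_of_real m_complex field_simps)
  ultimately show ?thesis by (simp add: x_def[abs_def] o_def)
qed

text \<open>
  The derivative of \<open>z' / cnj z\<close> contains \<open>z''\<close>, which is \<open>G\<close>, and \<open>|z'|\<^sup>2\<close>, which the energy identity eliminates.
  Then the terms with \<open>w\<close> cancel, and the remaining \<open>- 1 / (|z|\<^sup>2 (cnj z)\<^sup>2)\<close> is the Kepler force at \<open>z\<^sup>2\<close>.
\<close>
lemma v_deriv:
  assumes "z (\<sigma> y) \<noteq> 0"
  shows "(v has_vector_derivative - (x y /\<^sub>R norm (x y) ^ 3) + Vx y (x y)) (at y)"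
proof -
  define s where "s = \<sigma> y"
  define Z where "Z = z s"
  define X where "X = Vx y (x y)"
  have Z: "Z \<noteq> 0" "cnj Z \<noteq> 0" using assms by (simp_all add: Z_def s_def)
  have cnj: "((\<lambda>s. cnj (z s)) has_vector_derivative cnj (z' s)) (at s)"
    by (rule bounded_linear.has_vector_derivative[OF bounded_linear_cnj zD(4)])
  have "((\<lambda>s. of_real (2 / S) * (z' s / cnj (z s))) has_vector_derivative
      of_real (2 / S) * ((G s * cnj Z - z' s * cnj (z' s)) / (cnj Z)\<^sup>2)) (at s)"
    using Z unfolding Z_def
    by (intro has_vector_derivative_mult_right)
      (rule has_vector_derivative_quotient[OF zD(5) cnj])
  from vector_diff_chain_at[OF \<sigma>_deriv[OF assms] this[unfolded s_def]]
  have "(v has_vector_derivative inverse (S * m s) *\<^sub>R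
      (of_real (2 / S) * ((G s * cnj Z - z' s * cnj (z' s)) / (cnj Z)\<^sup>2))) (at y)"
    by (simp add: v_def[abs_def] o_def s_def)
  moreover have "inverse (S * m s) *\<^sub>R (of_real (2 / S) * ((G s * cnj Z - z' s * cnj (z' s)) / (cnj Z)\<^sup>2))
     = - (x y /\<^sub>R norm (x y) ^ 3) + X"
  proof -
    define W where "W = complex_of_real (w s)"
    define R where "R = complex_of_real S"
    have R: "R \<noteq> 0" using S_pos by (simp add: R_def)
    have mZ: "complex_of_real (m s) = Z * cnj Z" by (simp add: m_complex Z_def)
    have G: "G s = R\<^sup>2 / 2 * (W * Z + Z * cnj Z * (cnj Z * X))"
      by (simp add: G_def R_def W_def X_def scaleR_conv_of_real mZ x_def Z_def[symmetric] s_def[symmetric] t_\<sigma>[of y, folded s_def])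
    have "(norm (z' s))\<^sup>2 = S\<^sup>2 / 2 * (1 + w s * m s)"
      using energy_identity[of s] S_pos by (simp add: field_simps)
    then have "complex_of_real ((norm (z' s))\<^sup>2) = complex_of_real (S\<^sup>2 / 2 * (1 + w s * m s))" by (simp only:)
    then have E: "z' s * cnj (z' s) = R\<^sup>2 / 2 * (1 + W * (Z * cnj Z))"
      unfolding complex_norm_square by (simp add: R_def W_def mZ)
    have norm_x: "norm (x y) = m s" by (simp add: x_def norm_power m_def s_def)
    have x_Z: "x y = Z\<^sup>2" by (simp add: x_def Z_def s_def)
    then have x3: "x y /\<^sub>R norm (x y) ^ 3 = Z\<^sup>2 / (Z * cnj Z) ^ 3"
      unfolding norm_x unfolding x_Z by (simp add: scaleR_conv_of_real mZ divide_inverse)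
    have "inverse (S * m s) *\<^sub>R (of_real (2 / S) * ((G s * cnj Z - z' s * cnj (z' s)) / (cnj Z)\<^sup>2))
      = inverse (R * (Z * cnj Z)) * (2 / R * ((R\<^sup>2 / 2 * (W * Z + Z * cnj Z * (cnj Z * X)) * cnj Z
          - R\<^sup>2 / 2 * (1 + W * (Z * cnj Z))) / (cnj Z)\<^sup>2))"
      unfolding E G by (simp add: scaleR_conv_of_real mZ R_def)
    also have "\<dots> = - (Z\<^sup>2 / (Z * cnj Z) ^ 3) + X"
      using Z R by (simp add: field_simps power2_eq_square power3_eq_cube)
    finally show ?thesis by (simp add: x3)
  qed
  ultimately show ?thesis by (simp add: X_def)
qed

lemma energy_at:
  assumes "z (\<sigma> y) \<noteq> 0"
  shows "1 / 2 * (norm (v y))\<^sup>2 - 1 / norm (x y) = w (\<sigma> y)"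
proof -
  have m: "m (\<sigma> y) > 0" using assms by (simp add: m_def)
  have "1 / 2 * (norm (v y))\<^sup>2 = 2 / S\<^sup>2 * (norm (z' (\<sigma> y)))\<^sup>2 / m (\<sigma> y)"
    by (simp add: v_def norm_mult norm_divide power_mult_distrib power_divide m_def)
  also have "\<dots> = 1 / m (\<sigma> y) + w (\<sigma> y)"
    unfolding energy_identity using m by (simp add: field_simps)
  finally have "1 / 2 * (norm (v y))\<^sup>2 = 1 / m (\<sigma> y) + w (\<sigma> y)" .
  moreover have "norm (x y) = m (\<sigma> y)" by (simp add: x_def norm_power m_def)
  ultimately show ?thesis by (simp only: add_diff_cancel_left')
qed

text \<open>
  The quotient \<open>z s / (s - s0)\<close> has the nonzero limit \<open>z' s0\<close>, and normalising its square removes the positive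
  factor \<open>(s - s0)\<^sup>2\<close>; so the limits from the two sides agree.
\<close>
lemma x_direction:
  assumes "z (\<sigma> y) = 0"
  shows "\<exists>l. ((\<lambda>u. x u /\<^sub>R norm (x u)) \<longlongrightarrow> l) (at y)"
proof -
  define s0 where "s0 = \<sigma> y"
  have z0: "z s0 = 0" using assms by (simp add: s0_def)
  have "((\<lambda>s. (z s /\<^sub>R (s - s0))\<^sup>2 /\<^sub>R norm ((z s /\<^sub>R (s - s0))\<^sup>2)) \<longlongrightarrow>
      (z' s0)\<^sup>2 /\<^sub>R norm ((z' s0)\<^sup>2)) (at s0)"
    using z'_nonzero[OF z0] by (intro tendsto_intros z_quotient_tendsto z0) auto
  moreover have "\<forall>\<^sub>F s in at s0. (z s /\<^sub>R (s - s0))\<^sup>2 /\<^sub>R norm ((z s /\<^sub>R (s - s0))\<^sup>2) = (z s)\<^sup>2 /\<^sub>R norm ((z s)\<^sup>2)"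
    using z_eventually_nonzero[of s0] eventually_neq_at_within[of s0]
  proof eventually_elim
    case (elim s)
    have "(z s /\<^sub>R (s - s0))\<^sup>2 = (inverse (s - s0))\<^sup>2 *\<^sub>R (z s)\<^sup>2"
      by (simp add: power2_eq_square)
    then show ?case using elim by simp
  qed
  ultimately have "((\<lambda>s. (z s)\<^sup>2 /\<^sub>R norm ((z s)\<^sup>2)) \<longlongrightarrow> (z' s0)\<^sup>2 /\<^sub>R norm ((z' s0)\<^sup>2)) (at s0)"
    by (rule Lim_transform_eventually)
  from filterlim_compose[OF this \<sigma>_at[of y, folded s0_def]]
  show ?thesis by (auto simp: x_def)
qed

lemma x_eventually_nonzero: "\<forall>\<^sub>F u in at y. x u \<noteq> 0"
proof -
  have "\<forall>\<^sub>F u in at y. z (\<sigma> u) \<noteq> 0"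
    using z_eventually_nonzero \<sigma>_at[of y] by (auto simp: filterlim_iff)
  then show ?thesis by (simp add: x_def)
qed

lemma energy_limit: "((\<lambda>u. 1 / 2 * (norm (v u))\<^sup>2 - 1 / norm (x u)) \<longlongrightarrow> w (\<sigma> y)) (at y)"
proof -
  have "isCont (\<lambda>u. w (\<sigma> u)) y"
    using cont_w[OF cont_\<sigma>] by (simp add: continuous_on_eq_continuous_at)
  then have "((\<lambda>u. w (\<sigma> u)) \<longlongrightarrow> w (\<sigma> y)) (at y)" by (simp add: isCont_def)
  moreover have "\<forall>\<^sub>F u in at y. w (\<sigma> u) = 1 / 2 * (norm (v u))\<^sup>2 - 1 / norm (x u)"
    using x_eventually_nonzero[of y] by eventually_elim (rule energy_at[symmetric], simp add: x_def)
  ultimately show ?thesis by (rule Lim_transform_eventually)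
qed

lemma cont_x: "continuous_on UNIV x"
  unfolding x_def[abs_def] by (intro continuous_intros cont_\<sigma>)

lemma x_periodic: "x (y + T) = x y"
  by (simp add: x_def \<sigma>_shift z_square_periodic)

end

context forced_kepler
begin

text \<open>
  The solution in complex notation. Collisions are isolated, so the limits at a collision see only points
  where \<open>v\<close> is the velocity.
\<close>
lemma regularised_solution:
  obtains x v :: "real \<Rightarrow> complex"
  where "continuous_on UNIV x" "\<And>y. x (y + T) = x y"
    "\<And>y. x y \<noteq> 0 \<Longrightarrow> (x has_vector_derivative v y) (at y)"
    "\<And>y. x y \<noteq> 0 \<Longrightarrow> (v has_vector_derivative - (x y /\<^sub>R norm (x y) ^ 3) + Vx y (x y)) (at y)"
    "\<And>y. \<forall>\<^sub>F u in at y. x u \<noteq> 0"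
    "\<And>y. x y = 0 \<Longrightarrow> \<exists>l. ((\<lambda>u. x u /\<^sub>R norm (x u)) \<longlongrightarrow> l) (at y)"
    "\<And>y. \<exists>h. ((\<lambda>u. 1 / 2 * (norm (v u))\<^sup>2 - 1 / norm (x u)) \<longlongrightarrow> h) (at y)"
proof (rule relaxed_minimiser)
  fix z \<tau> e
  assume *: "continuous_on UNIV z" "antiperiodic z" "mean_square z > 0"
    "\<And>\<phi> \<phi>' \<phi>'' \<theta> \<epsilon>. C2_loop \<phi> \<phi>' \<phi>'' \<Longrightarrow> mean_square (\<lambda>s. z s + \<epsilon> *\<^sub>R \<phi> s) > 0 \<Longrightarrow>
      action z \<tau> e \<le> action (\<lambda>s. z s + \<epsilon> *\<^sub>R \<phi> s) (\<tau> + \<epsilon> * \<theta>)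
        (e - 2 * \<epsilon> * integral {0..1} (\<lambda>s. z s \<bullet> \<phi>'' s) + \<epsilon>\<^sup>2 * mean_square \<phi>')"
    "\<And>\<phi> \<phi>' \<phi>''. C2_loop \<phi> \<phi>' \<phi>'' \<Longrightarrow>
      0 \<le> e + 2 * integral {0..1} (\<lambda>s. z s \<bullet> \<phi>'' s) + mean_square \<phi>'"
    "\<And>y y' y'' \<sigma>. C2_loop y y' y'' \<Longrightarrow> mean_square y > 0 \<Longrightarrow>
      action z \<tau> e \<le> action y \<sigma> (mean_square y')"
  interpret L: relaxed_minimising_loop T C \<alpha> V Vt Vx z \<tau> e
    by unfold_locales (fact *)+
  show thesis
  proof (rule that[of L.x L.v])
    show "(L.x has_vector_derivative L.v y) (at y)" if "L.x y \<noteq> 0" for y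
      using that by (intro L.x_deriv) (simp add: L.x_def)
    show "(L.v has_vector_derivative - (L.x y /\<^sub>R norm (L.x y) ^ 3) + Vx y (L.x y)) (at y)" if "L.x y \<noteq> 0" for y
      using that by (intro L.v_deriv) (simp add: L.x_def)
    show "\<exists>l. ((\<lambda>u. L.x u /\<^sub>R norm (L.x u)) \<longlongrightarrow> l) (at y)" if "L.x y = 0" for y
      using that by (intro L.x_direction) (simp add: L.x_def)
    show "\<exists>h. ((\<lambda>u. 1 / 2 * (norm (L.v u))\<^sup>2 - 1 / norm (L.x u)) \<longlongrightarrow> h) (at y)" for y
      using L.energy_limit by blast
  qed (rule L.cont_x L.x_periodic L.x_eventually_nonzero)+
qed

end

section \<open>The solution in the real plane\<close>

definition plane :: "complex \<Rightarrow> real^2" where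
  "plane c = Re c *\<^sub>R axis 1 1 + Im c *\<^sub>R axis 2 1"

lemma bounded_linear_plane: "bounded_linear plane"
  unfolding plane_def[abs_def]
  by (intro bounded_linear_add bounded_linear_compose[OF bounded_linear_scaleR_left]
      bounded_linear_Re bounded_linear_Im)

lemma plane_nth [simp]: "plane c $ 1 = Re c" "plane c $ 2 = Im c"
  by (simp_all add: plane_def axis_def)

lemma plane_inner [simp]: "plane a \<bullet> plane b = a \<bullet> b"
  by (simp add: inner_vec_def sum_2 inner_complex_def)

lemma plane_norm [simp]: "norm (plane a) = norm a"
  by (simp add: norm_eq_sqrt_inner)

lemma plane_eq_0 [simp]: "plane a = 0 \<longleftrightarrow> a = 0"
  by (metis norm_eq_zero plane_norm)

lemma plane_surj: "\<exists>c. x = plane c"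
  by (rule exI[of _ "Complex (x $ 1) (x $ 2)"]) (simp add: vec_eq_iff forall_2)

lemmas plane_linear = linear_simps[OF bounded_linear_plane]

lemma gradient_eqI:
  assumes "(f has_derivative (\<lambda>h. h \<bullet> D)) (at x)"
  shows "gradient f x = D"
  unfolding gradient_def gderiv_def
proof (rule the_equality)
  show "(f has_derivative (\<lambda>h. h \<bullet> D)) (at x)" by (fact assms)
  fix D' assume "(f has_derivative (\<lambda>h. h \<bullet> D')) (at x)"
  from has_derivative_unique[OF this assms] have "h \<bullet> D' = h \<bullet> D" for h by (simp add: fun_eq_iff)
  then show "D' = D" using vector_eq_ldot by blast
qed

theorem theorem1p2:
  fixes T C \<alpha> :: real
    and U :: "real \<times> (real^2) \<Rightarrow> real"
  assumes "T > 0"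
    and "continuously_differentiable U"
    and "\<And>t x. U (t + T, x) = U (t, x)"
    and "C > 0"
    and "0 < \<alpha>" and "\<alpha> < 2"
    and "\<And>t x. \<bar>U (t, x)\<bar> \<le> C * (1 + norm x powr \<alpha>)"
  shows "\<exists>x. generalized_periodic_solution T U x"
proof -
  obtain U' :: "real \<times> (real^2) \<Rightarrow> ((real \<times> (real^2)) \<Rightarrow>\<^sub>L real)"
    where U': "\<And>p. (U has_derivative blinfun_apply (U' p)) (at p)" and cont_U': "continuous_on UNIV U'"
    using assms(2) unfolding continuously_differentiable_def by blast
  define V where "V t c = U (t, plane c)" for t c
  define Vt where "Vt t c = U' (t, plane c) (1, 0)" for t c
  define Vx where "Vx t c = Complex (U' (t, plane c) (0, axis 1 1)) (U' (t, plane c) (0, axis 2 1))" for t c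
  have U'_eq: "U' (t, plane c) (a, plane b) = Vt t c * a + Vx t c \<bullet> b" for t c a b
  proof -
    have "(a, plane b) = a *\<^sub>R (1, 0) + (Re b *\<^sub>R (0, axis 1 1) + Im b *\<^sub>R (0, axis 2 1))"
      by (simp add: plane_def)
    then show ?thesis
      by (simp only: blinfun.add_right blinfun.scaleR_right)
        (simp add: Vt_def Vx_def inner_complex_def)
  qed
  have cont: "continuous_on UNIV (\<lambda>p. U' (fst p, plane (snd p)) d)" for d
    by (intro continuous_intros continuous_on_compose2[OF cont_U']
        bounded_linear.continuous_on[OF bounded_linear_plane]) auto
  interpret forced_kepler T C \<alpha> V Vt Vx
  proof
    fix p :: "real \<times> complex"
    have lin: "bounded_linear (\<lambda>p. (fst p, plane (snd p)))"
      by (intro bounded_linear_Pair bounded_linear_fst bounded_linear_compose[OF bounded_linear_plane bounded_linear_snd])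
    have "((\<lambda>p. U (fst p, plane (snd p))) has_derivative
        (\<lambda>h. U' (fst p, plane (snd p)) (fst h, plane (snd h)))) (at p)"
      by (rule has_derivative_compose[OF bounded_linear_imp_has_derivative[OF lin] U'])
    then show "((\<lambda>p. V (fst p) (snd p)) has_derivative
          (\<lambda>h. Vt (fst p) (snd p) * fst h + Vx (fst p) (snd p) \<bullet> snd h)) (at p)"
      by (simp add: U'_eq V_def)
    show "continuous_on UNIV (\<lambda>p. Vt (fst p) (snd p))"
      unfolding Vt_def by (rule cont)
    show "continuous_on UNIV (\<lambda>p. Vx (fst p) (snd p))"
      unfolding Vx_def Complex_eq by (intro continuous_intros cont)
    show "\<bar>V t c\<bar> \<le> C * (1 + norm c powr \<alpha>)" for t c
      using assms(7)[of t "plane c"] by (simp add: V_def)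
    show "V (t + T) c = V t c" for t c
      by (simp add: V_def assms(3))
  qed (fact assms)+
  have grad: "gradient (\<lambda>y. U (t, y)) (plane c) = plane (Vx t c)" for t c
  proof (rule gradient_eqI)
    have "((\<lambda>y. (t, y)) has_derivative (\<lambda>h. (0, h))) (at (plane c))"
      by (intro derivative_eq_intros) auto
    from has_derivative_compose[OF this U']
    have "((\<lambda>y. U (t, y)) has_derivative (\<lambda>h. U' (t, plane c) (0, h))) (at (plane c))" .
    moreover have "U' (t, plane c) (0, h) = h \<bullet> plane (Vx t c)" for h
      using plane_surj[of h] U'_eq[of t c 0] by (auto simp: inner_commute)
    ultimately show "((\<lambda>y. U (t, y)) has_derivative (\<lambda>h. h \<bullet> plane (Vx t c))) (at (plane c))" by simp
  qed
  obtain x v :: "real \<Rightarrow> complex"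
    where cont_x: "continuous_on UNIV x" and period: "\<And>y. x (y + T) = x y"
    and x: "\<And>y. x y \<noteq> 0 \<Longrightarrow> (x has_vector_derivative v y) (at y)"
    and v: "\<And>y. x y \<noteq> 0 \<Longrightarrow> (v has_vector_derivative - (x y /\<^sub>R norm (x y) ^ 3) + Vx y (x y)) (at y)"
    and isolated: "\<And>y. \<forall>\<^sub>F u in at y. x u \<noteq> 0"
    and direction: "\<And>y. x y = 0 \<Longrightarrow> \<exists>l. ((\<lambda>u. x u /\<^sub>R norm (x u)) \<longlongrightarrow> l) (at y)"
    and energy: "\<And>y. \<exists>h. ((\<lambda>u. 1 / 2 * (norm (v u))\<^sup>2 - 1 / norm (x u)) \<longlongrightarrow> h) (at y)"
    by (rule regularised_solution) blast
  define X where "X t = plane (x t)" for t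
  define a where "a t = - (x t /\<^sub>R norm (x t) ^ 3) + Vx t (x t)" for t
  have open_nz: "open {t. x t \<noteq> 0}"
    using open_Collect_neq[OF cont_x continuous_on_const[of UNIV 0]] by simp
  have X: "(X has_vector_derivative plane (v t)) (at t)" if "x t \<noteq> 0" for t
    unfolding X_def[abs_def] by (rule bounded_linear.has_vector_derivative[OF bounded_linear_plane x[OF that]])
  then have vel: "velocity X t = plane (v t)" if "x t \<noteq> 0" for t
    using that by (intro vector_derivative_at) blast
  have acc: "(velocity X has_vector_derivative plane (a t)) (at t)" if "x t \<noteq> 0" for t
  proof (rule has_vector_derivative_transform_within_open[OF _ open_nz])
    show "((\<lambda>t. plane (v t)) has_vector_derivative plane (a t)) (at t)"
      unfolding a_def by (rule bounded_linear.has_vector_derivative[OF bounded_linear_plane v[OF that]])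
  qed (use that vel in auto)
  have cont_v: "continuous_on I v" if "\<And>t. t \<in> I \<Longrightarrow> x t \<noteq> 0" for I
    using v that by (meson continuous_at_imp_continuous_on has_vector_derivative_continuous)
  have cont_a: "continuous_on I a" if "\<And>t. t \<in> I \<Longrightarrow> x t \<noteq> 0" for I
    unfolding a_def using that by (intro continuous_intros continuous_on_subset[OF cont_x]) auto
  have "X C2_differentiable_on I \<and> (\<forall>t\<in>I. velocity (velocity X) t =
      - (X t /\<^sub>R norm (X t) ^ 3) + gradient (\<lambda>y. U (t, y)) (X t))"
    if "I \<subseteq> - collision_instants X" for I
  proof -
    have nz: "x t \<noteq> 0" if "t \<in> I" for t
      using \<open>I \<subseteq> _\<close> that by (auto simp: collision_instants_def X_def)
    have "X C1_differentiable_on I"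
      unfolding C1_differentiable_on_def
      by (intro exI[of _ "\<lambda>t. plane (v t)"] conjI ballI X nz
          bounded_linear.continuous_on[OF bounded_linear_plane cont_v])
    moreover have "velocity X C1_differentiable_on I"
      unfolding C1_differentiable_on_def
      by (intro exI[of _ "\<lambda>t. plane (a t)"] conjI ballI acc nz
          bounded_linear.continuous_on[OF bounded_linear_plane cont_a])
    moreover have "velocity (velocity X) t = - (X t /\<^sub>R norm (X t) ^ 3) + gradient (\<lambda>y. U (t, y)) (X t)"
      if "t \<in> I" for t
      using vector_derivative_at[OF acc[OF nz[OF that]]]
      by (simp add: X_def grad a_def plane_linear)
    ultimately show ?thesis by (simp add: C2_differentiable_on_def)
  qed
  moreover have "continuous_on UNIV X"
    unfolding X_def[abs_def] by (rule bounded_linear.continuous_on[OF bounded_linear_plane cont_x])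
  moreover have "X (t + T) = X t" for t by (simp add: X_def period)
  moreover have "discrete (collision_instants X)"
    using isolated by (simp add: discrete_altdef collision_instants_def X_def)
  moreover have "\<exists>l. ((\<lambda>t. X t /\<^sub>R norm (X t)) \<longlongrightarrow> l) (at t0)" if "t0 \<in> collision_instants X" for t0
  proof -
    have "x t0 = 0" using that by (simp add: collision_instants_def X_def)
    then obtain l where "((\<lambda>u. x u /\<^sub>R norm (x u)) \<longlongrightarrow> l) (at t0)" using direction by blast
    from bounded_linear.tendsto[OF bounded_linear_plane this] show ?thesis
      by (auto simp: X_def plane_linear)
  qed
  moreover have "\<exists>h. ((\<lambda>t. (1/2) * norm (velocity X t) ^ 2 - 1 / norm (X t)) \<longlongrightarrow> h) (at t0)" for t0
  proof -
    obtain h where "((\<lambda>u. 1 / 2 * (norm (v u))\<^sup>2 - 1 / norm (x u)) \<longlongrightarrow> h) (at t0)" using energy by blast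
    moreover have "\<forall>\<^sub>F u in at t0. 1 / 2 * (norm (v u))\<^sup>2 - 1 / norm (x u)
        = (1/2) * norm (velocity X u) ^ 2 - 1 / norm (X u)"
      using isolated[of t0] by eventually_elim (simp add: vel X_def)
    ultimately show ?thesis by (blast intro: Lim_transform_eventually)
  qed
  ultimately have "generalized_periodic_solution T U X"
    unfolding generalized_periodic_solution_def by blast
  then show ?thesis by (rule exI[of _ X])
qed

end
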